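(* Let $A_1,\dots,A_M\in\mathbb{R}^{n\times n}$, $\mathcal{M}=\{1,\dots,M\}$ and $A(w)=\sum_{i\in\mathcal{M}}w_iA_i$ for $w\in\mathcal{W}$. If the difference inclusion $x(k+1)=A(w(k))x(k)$ (resp. the differential inclusion $\dot x(t)=A(w(t))x(t)$) is strongly convergent, then it admits a weak polyhedral Lyapunov function.
   Context: $\mathcal{W}=\{w\in\mathbb{R}^M:\ \sum_{i\in\mathcal{M}}w_i=1,\ w_i\ge0\ \forall i\in\mathcal{M}\}$. Let $\bar{\mathcal{X}}=\bigcap_{i\in\mathcal{M}}\ker(A_i-I)$ in discrete time and $\bar{\mathcal{X}}=\bigcap_{i\in\mathcal{M}}\ker(A_i)$ in continuous time. The inclusion is strongly convergent if for every sequence $w(k)\in\mathcal{W}$, $k\in\mathbb{N}$ (resp. every measurable function $w(t)\in\mathcal{W}$, $t\ge0$) and every $x(0)\in\mathbb{R}^n$ the solution converges, as time tends to infinity, to some $\bar x\in\bar{\mathcal{X}}$. A weak Lyapunov function is a positive definite function $V:\mathbb{R}^n\to\mathbb{R}_{\ge0}$ such that, for all $x\in\mathbb{R}^n$ and $w\in\mathcal{W}$, $V(A(w)x)\le V(x)$ in discrete time, and $\limsup_{h\to0^+}\frac{V(x+hA(w)x)-V(x)}{h}\le0$ in continuous time. It is a weak polyhedral Lyapunov function if moreover $V(x)=\max_{i=1,\dots,s}f_i^\top x$ for some vectors $f_1,\dots,f_s\in\mathbb{R}^n$. *)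

theory Defs
  imports "HOL-Analysis.Analysis"
begin

text \<open>
  The index set of the matrices is a finite type \<open>'m\<close> and the state space is \<open>real ^ 'n\<close>,
  so that M and n are the cardinalities of \<open>'m\<close> and \<open>'n\<close>.
\<close>

definition weights :: "(real ^ 'm) set" where
  "weights = {w. (\<Sum>i\<in>UNIV. w $ i) = 1 \<and> (\<forall>i. 0 \<le> w $ i)}"

definition comb :: "('m::finite \<Rightarrow> real ^ 'n ^ 'n) \<Rightarrow> real ^ 'm \<Rightarrow> real ^ 'n ^ 'n" where
  "comb A w = (\<Sum>i\<in>UNIV. w $ i *\<^sub>R A i)"

definition matrix_ker :: "real ^ 'n ^ 'n \<Rightarrow> (real ^ 'n) set" where
  "matrix_ker B = {x. B *v x = 0}"

definition equilibria_dt :: "('m::finite \<Rightarrow> real ^ 'n ^ 'n) \<Rightarrow> (real ^ 'n) set" where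
  "equilibria_dt A = (\<Inter>i. matrix_ker (A i - mat 1))"

definition equilibria_ct :: "('m::finite \<Rightarrow> real ^ 'n ^ 'n) \<Rightarrow> (real ^ 'n) set" where
  "equilibria_ct A = (\<Inter>i. matrix_ker (A i))"

definition solution_dt ::
  "('m::finite \<Rightarrow> real ^ 'n ^ 'n) \<Rightarrow> (nat \<Rightarrow> real ^ 'm) \<Rightarrow> (nat \<Rightarrow> real ^ 'n) \<Rightarrow> bool" where
  "solution_dt A w x \<longleftrightarrow> (\<forall>k. x (Suc k) = comb A (w k) *v x k)"

text \<open>
  Since \<open>w\<close> is only measurable, a solution in continuous time is meant in the sense of
  Caratheodory: the right-hand side is Lebesgue integrable along \<open>x\<close> on bounded intervals
  and \<open>x\<close> is its indefinite integral.  Only the values for \<open>t \<ge> 0\<close> matter.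
\<close>

definition solution_ct ::
  "('m::finite \<Rightarrow> real ^ 'n ^ 'n) \<Rightarrow> (real \<Rightarrow> real ^ 'm) \<Rightarrow> (real \<Rightarrow> real ^ 'n) \<Rightarrow> bool" where
  "solution_ct A w x \<longleftrightarrow>
     (\<forall>t\<ge>0. (\<lambda>s. comb A (w s) *v x s) absolutely_integrable_on {0..t} \<and>
            x t = x 0 + integral {0..t} (\<lambda>s. comb A (w s) *v x s))"

definition strongly_convergent_dt :: "('m::finite \<Rightarrow> real ^ 'n ^ 'n) \<Rightarrow> bool" where
  "strongly_convergent_dt A \<longleftrightarrow>
     (\<forall>w x0 x. (\<forall>k. w k \<in> weights) \<longrightarrow> solution_dt A w x \<longrightarrow> x 0 = x0 \<longrightarrow>
        (\<exists>xbar \<in> equilibria_dt A. x \<longlonglongrightarrow> xbar))"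

definition strongly_convergent_ct :: "('m::finite \<Rightarrow> real ^ 'n ^ 'n) \<Rightarrow> bool" where
  "strongly_convergent_ct A \<longleftrightarrow>
     (\<forall>w x0 x. w \<in> borel_measurable (lebesgue_on {0..}) \<longrightarrow> (\<forall>t\<ge>0. w t \<in> weights) \<longrightarrow>
        solution_ct A w x \<longrightarrow> x 0 = x0 \<longrightarrow>
        (\<exists>xbar \<in> equilibria_ct A. (x \<longlongrightarrow> xbar) at_top))"

definition positive_definite :: "(real ^ 'n \<Rightarrow> real) \<Rightarrow> bool" where
  "positive_definite V \<longleftrightarrow> V 0 = 0 \<and> (\<forall>x. x \<noteq> 0 \<longrightarrow> 0 < V x)"

definition weak_Lyapunov_dt :: "('m::finite \<Rightarrow> real ^ 'n ^ 'n) \<Rightarrow> (real ^ 'n \<Rightarrow> real) \<Rightarrow> bool" where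
  "weak_Lyapunov_dt A V \<longleftrightarrow>
     positive_definite V \<and> (\<forall>x. \<forall>w\<in>weights. V (comb A w *v x) \<le> V x)"

text \<open>The upper Dini derivative is taken in the extended reals, where the limsup always exists.\<close>

definition weak_Lyapunov_ct :: "('m::finite \<Rightarrow> real ^ 'n ^ 'n) \<Rightarrow> (real ^ 'n \<Rightarrow> real) \<Rightarrow> bool" where
  "weak_Lyapunov_ct A V \<longleftrightarrow>
     positive_definite V \<and>
     (\<forall>x. \<forall>w\<in>weights.
        Limsup (at_right 0) (\<lambda>h. ereal ((V (x + h *\<^sub>R (comb A w *v x)) - V x) / h)) \<le> 0)"

definition polyhedral :: "(real ^ 'n \<Rightarrow> real) \<Rightarrow> bool" where
  "polyhedral V \<longleftrightarrow>
     (\<exists>(s::nat) (f :: nat \<Rightarrow> real ^ 'n). s \<ge> 1 \<and> (\<forall>x. V x = (MAX i\<in>{1..s}. f i \<bullet> x)))"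

definition weak_polyhedral_Lyapunov_dt ::
  "('m::finite \<Rightarrow> real ^ 'n ^ 'n) \<Rightarrow> (real ^ 'n \<Rightarrow> real) \<Rightarrow> bool" where
  "weak_polyhedral_Lyapunov_dt A V \<longleftrightarrow> weak_Lyapunov_dt A V \<and> polyhedral V"

definition weak_polyhedral_Lyapunov_ct ::
  "('m::finite \<Rightarrow> real ^ 'n ^ 'n) \<Rightarrow> (real ^ 'n \<Rightarrow> real) \<Rightarrow> bool" where
  "weak_polyhedral_Lyapunov_ct A V \<longleftrightarrow> weak_Lyapunov_ct A V \<and> polyhedral V"

end

theory Submission
  imports Defs
begin

text \<open>
  Both halves rest on one construction.  Write the dynamics through generators \<open>G i\<close>, with
  \<open>G i = A i - I\<close> in discrete time and \<open>G i = A i\<close> in continuous time, and measure how fast a state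
  can move by the polyhedral seminorm \<open>speed G x\<close>, the sum of the 1-norms of the vectors \<open>G i x\<close>.
  Its kernel is exactly the set of common equilibria.  For a step \<open>h > 0\<close> consider the Euler
  trajectories, whose steps are \<open>x + h G i x\<close> with a free choice of \<open>i\<close>; with \<open>h = 1\<close> these
  are the vertex trajectories of the difference inclusion.

  Suppose that every Euler trajectory of step \<open>h\<close> halves its speed within a fixed number of steps.
  Then the speed decays uniformly, so for some \<open>m\<close> the worst speed after \<open>m\<close> steps is at most
  half the initial one.  Let \<open>Q k x\<close> be the worst speed after \<open>k\<close> steps from \<open>x\<close>.  One step from \<open>x\<close>
  shifts the sum of \<open>Q k x\<close> over \<open>k < m\<close>, so that this sum drops by at least
  \<open>speed G x / 2\<close>, whereas the 1-norm of \<open>x\<close> grows by at most \<open>h * speed G x\<close>.  Therefore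
  the 1-norm plus \<open>2 * h\<close> times the sum does not increase.  It is a maximum of finitely many
  linear functionals, and it is positive definite because of the 1-norm
  (\<open>euler_Lyapunov_function\<close>).  Convexity extends the decrease from the vertices to all weights and,
  in continuous time, from the step \<open>h\<close> to all shorter steps, hence to the Dini derivative.

  It remains to derive a halving time from strong convergence, and this is a compactness argument.
  If there is none, then there are arbitrarily long trajectories that stay fast.  The dynamics does
  not change when an equilibrium is subtracted, so the initial states can be kept in a fixed ball,
  and Tychonoff's theorem yields a single infinite trajectory whose speed stays at least \<open>1/2\<close>;
  it cannot converge to an equilibrium.

  In continuous time the step has to tend to 0 at the same time, and the switching signals need not
  have a meaningful pointwise limit: they may oscillate ever faster.  Their integrals \<open>F t\<close>, which
  record how much time has been given to each generator, do accumulate pointwise.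
  An Euler trajectory and its \<open>F\<close> satisfy \<open>x t - x s = comb G (F t - F s) x s\<close> up to an error of
  second order in \<open>t - s\<close> plus the step, a condition that involves only two times and so survives pointwise limits
  (\<open>relaxed_trajectory\<close>).  In the limit the components of \<open>F\<close> are monotone and add up to \<open>t\<close>,
  so the Radon--Nikodym theorem gives a measurable weight function whose integral is \<open>F\<close>
  (\<open>time_split_density\<close>); the difference between \<open>x\<close> and the integral of the right-hand side then
  has increments of second order and is constant.
\<close>

section \<open>Maxima of finitely many linear functionals\<close>

text \<open>
  Indexing by a finite set rather than by \<open>{1..s}\<close> makes the closure properties below simple images,
  products and unions; giving the maximum by a bound that is attained avoids \<open>Max\<close> of an image.
\<close>

definition max_linear :: "(real ^ 'n \<Rightarrow> real) \<Rightarrow> bool" where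
  "max_linear V \<longleftrightarrow>
     (\<exists>S. finite S \<and> S \<noteq> {} \<and> (\<forall>x. (\<forall>f\<in>S. f \<bullet> x \<le> V x) \<and> (\<exists>f\<in>S. V x = f \<bullet> x)))"

lemma max_linearI:
  assumes "finite S" "\<And>x f. f \<in> S \<Longrightarrow> f \<bullet> x \<le> V x" "\<And>x. \<exists>f\<in>S. V x = f \<bullet> x"
  shows "max_linear V"
  unfolding max_linear_def using assms by (metis empty_iff)

lemma max_linearE:
  assumes "max_linear V"
  obtains S where "finite S" "S \<noteq> {}" "\<And>x f. f \<in> S \<Longrightarrow> f \<bullet> x \<le> V x" "\<And>x. \<exists>f\<in>S. V x = f \<bullet> x"
  using assms unfolding max_linear_def by metis

lemma max_linear_imp_polyhedral:
  assumes "max_linear V"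
  shows "polyhedral V"
proof -
  obtain S where S: "finite S" "S \<noteq> {}" "\<And>x f. f \<in> S \<Longrightarrow> f \<bullet> x \<le> V x"
    "\<And>x. \<exists>f\<in>S. V x = f \<bullet> x"
    using max_linearE[OF assms] by metis
  obtain g where g: "bij_betw g {1..card S} S"
    using ex_bij_betw_nat_finite_1[OF \<open>finite S\<close>] by blast
  then have img: "g ` {1..card S} = S"
    by (rule bij_betw_imp_surj_on)
  have "V x = (MAX i\<in>{1..card S}. g i \<bullet> x)" for x
  proof -
    have "(\<lambda>i. g i \<bullet> x) ` {1..card S} = (\<lambda>f. f \<bullet> x) ` S"
      using arg_cong[OF img, of "image (\<lambda>f. f \<bullet> x)"] by (simp only: image_image)
    moreover have "Max ((\<lambda>f. f \<bullet> x) ` S) = V x"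
      using S by (intro Max_eqI) auto
    ultimately show ?thesis by simp
  qed
  moreover have "card S \<ge> 1"
    using S by (simp add: Suc_leI card_gt_0_iff)
  ultimately show ?thesis
    unfolding polyhedral_def by blast
qed

lemma max_linear_add:
  assumes "max_linear V" "max_linear W"
  shows "max_linear (\<lambda>x. V x + W x)"
proof -
  obtain S where S: "finite S" "\<And>x f. f \<in> S \<Longrightarrow> f \<bullet> x \<le> V x" "\<And>x. \<exists>f\<in>S. V x = f \<bullet> x"
    using max_linearE[OF assms(1)] by metis
  obtain T where T: "finite T" "\<And>x f. f \<in> T \<Longrightarrow> f \<bullet> x \<le> W x" "\<And>x. \<exists>f\<in>T. W x = f \<bullet> x"
    using max_linearE[OF assms(2)] by metis
  show ?thesis
  proof (rule max_linearI[of "(\<lambda>(f, g). f + g) ` (S \<times> T)"])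
    show "finite ((\<lambda>(f, g). f + g) ` (S \<times> T))"
      using S T by blast
    show "\<exists>f\<in>(\<lambda>(f, g). f + g) ` (S \<times> T). V x + W x = f \<bullet> x" for x
    proof -
      obtain f g where "f \<in> S" "V x = f \<bullet> x" "g \<in> T" "W x = g \<bullet> x"
        using S(3) T(3) by metis
      then show ?thesis
        by (intro bexI[of _ "f + g"]) (auto simp: inner_add_left)
    qed
  qed (use S T in \<open>auto simp: inner_add_left add_mono\<close>)
qed

lemma max_linear_zero: "max_linear (\<lambda>x. 0)"
  by (rule max_linearI[of "{0}"]) auto

lemma max_linear_sum:
  assumes "\<And>i. i \<in> I \<Longrightarrow> max_linear (V i)"
  shows "max_linear (\<lambda>x. \<Sum>i\<in>I. V i x)"
  using assms
  by (induction I rule: infinite_finite_induct) (auto simp: max_linear_zero max_linear_add)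

lemma max_linear_scale:
  assumes "max_linear V" "0 \<le> c"
  shows "max_linear (\<lambda>x. c * V x)"
proof -
  obtain S where S: "finite S" "\<And>x f. f \<in> S \<Longrightarrow> f \<bullet> x \<le> V x" "\<And>x. \<exists>f\<in>S. V x = f \<bullet> x"
    using max_linearE[OF assms(1)] by metis
  show ?thesis
    by (rule max_linearI[of "(\<lambda>f. c *\<^sub>R f) ` S"])
       (use S assms(2) in \<open>force simp: mult_left_mono\<close>)+
qed

lemma max_linear_abs_inner: "max_linear (\<lambda>x. \<bar>f \<bullet> x\<bar>)"
  by (rule max_linearI[of "{f, -f}"]) (auto simp: abs_if)

lemma max_linear_compose_matrix:
  assumes "max_linear V"
  shows "max_linear (\<lambda>x. V (B *v x))"
proof -
  obtain S where S: "finite S" "\<And>x f. f \<in> S \<Longrightarrow> f \<bullet> x \<le> V x" "\<And>x. \<exists>f\<in>S. V x = f \<bullet> x"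
    using max_linearE[OF assms] by metis
  show ?thesis
    by (rule max_linearI[of "(\<lambda>f. f v* B) ` S"])
       (use S in \<open>auto simp: dot_lmul_matrix\<close>)
qed

lemma max_linear_Max:
  fixes V :: "'i::finite \<Rightarrow> real ^ 'n \<Rightarrow> real"
  assumes "\<And>i. max_linear (V i)"
  shows "max_linear (\<lambda>x. MAX i. V i x)"
proof -
  have "\<exists>S. finite S \<and> (\<forall>x. (\<forall>f\<in>S. f \<bullet> x \<le> V i x) \<and> (\<exists>f\<in>S. V i x = f \<bullet> x))" for i
    using assms unfolding max_linear_def by metis
  then obtain S where S: "\<And>i. finite (S i)" "\<And>i x f. f \<in> S i \<Longrightarrow> f \<bullet> x \<le> V i x"
    "\<And>i x. \<exists>f\<in>S i. V i x = f \<bullet> x"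
    by metis
  have ge: "V i x \<le> (MAX i. V i x)" for i x
    by simp
  show ?thesis
  proof (rule max_linearI[of "\<Union>i. S i"])
    show "finite (\<Union>i. S i)"
      using S(1) by (intro finite_UN_I) auto
    show "f \<bullet> x \<le> (MAX i. V i x)" if "f \<in> (\<Union>i. S i)" for x f
      using that S(2) ge order_trans by fast
    show "\<exists>f\<in>\<Union>i. S i. (MAX i. V i x) = f \<bullet> x" for x
    proof -
      have "(MAX i. V i x) \<in> range (\<lambda>i. V i x)"
        by (rule Max_in) auto
      then obtain i where "(MAX i. V i x) = V i x"
        by blast
      with S(3)[of i x] show ?thesis
        by auto
    qed
  qed
qed

text \<open>
  Convexity: the functional that attains the maximum at the combination is linear and lies below
  \<open>V\<close> at each of the points.
\<close>

lemma max_linear_sublinear: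
  assumes "max_linear V" "\<And>i. i \<in> I \<Longrightarrow> 0 \<le> c i"
  shows "V (\<Sum>i\<in>I. c i *\<^sub>R y i) \<le> (\<Sum>i\<in>I. c i * V (y i))"
proof -
  obtain S where S: "\<And>x f. f \<in> S \<Longrightarrow> f \<bullet> x \<le> V x" "\<And>x. \<exists>f\<in>S. V x = f \<bullet> x"
    using max_linearE[OF assms(1)] by metis
  obtain f where f: "f \<in> S" "V (\<Sum>i\<in>I. c i *\<^sub>R y i) = f \<bullet> (\<Sum>i\<in>I. c i *\<^sub>R y i)"
    using S(2) by metis
  note f(2)
  also have "\<dots> = (\<Sum>i\<in>I. c i * (f \<bullet> y i))"
    by (simp add: inner_sum_right)
  also have "\<dots> \<le> (\<Sum>i\<in>I. c i * V (y i))"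
    using S(1)[OF f(1)] assms(2) by (intro sum_mono mult_left_mono) auto
  finally show ?thesis .
qed

section \<open>The speed seminorm and Euler trajectories\<close>

definition l1_norm :: "real ^ 'n \<Rightarrow> real" where
  "l1_norm x = (\<Sum>j\<in>UNIV. \<bar>x $ j\<bar>)"

lemma max_linear_l1_norm: "max_linear l1_norm"
proof -
  have "max_linear (\<lambda>x::real^'n. \<Sum>j\<in>UNIV. \<bar>axis j 1 \<bullet> x\<bar>)"
    by (intro max_linear_sum max_linear_abs_inner)
  then show ?thesis
    by (simp add: l1_norm_def[abs_def] inner_axis')
qed

lemma l1_norm_triangle: "l1_norm (x + y) \<le> l1_norm x + l1_norm y"
  unfolding l1_norm_def sum.distrib[symmetric] by (intro sum_mono) (simp add: abs_triangle_ineq)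

lemma l1_norm_scale: "l1_norm (c *\<^sub>R x) = \<bar>c\<bar> * l1_norm x"
  by (simp add: l1_norm_def abs_mult sum_distrib_left)

lemma l1_norm_nonneg: "0 \<le> l1_norm x"
  by (simp add: l1_norm_def sum_nonneg)

lemma norm_le_l1_norm: "norm x \<le> l1_norm x"
  unfolding l1_norm_def by (rule norm_le_l1_cart)

lemma l1_norm_le_norm: "l1_norm (x :: real ^ 'n) \<le> real CARD('n) * norm x"
  using sum_bounded_above[of UNIV "\<lambda>j. \<bar>x $ j\<bar>" "norm x"]
  by (simp add: l1_norm_def component_le_norm_cart)

text \<open>
  The 1-norm is chosen because it is polyhedral, and the sum over the generators because it vanishes
  only at a common zero of all of them.
\<close>

definition speed :: "('m::finite \<Rightarrow> real ^ 'n ^ 'n) \<Rightarrow> real ^ 'n \<Rightarrow> real" where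
  "speed G x = (\<Sum>i\<in>UNIV. l1_norm (G i *v x))"

lemma max_linear_speed: "max_linear (speed G)"
  unfolding speed_def[abs_def]
  by (intro max_linear_sum max_linear_compose_matrix[OF max_linear_l1_norm])

lemma speed_triangle: "speed G (x + y) \<le> speed G x + speed G y"
  unfolding speed_def sum.distrib[symmetric]
  by (intro sum_mono) (simp add: matrix_vector_right_distrib l1_norm_triangle)

lemma speed_scale: "speed G (c *\<^sub>R x) = \<bar>c\<bar> * speed G x"
  by (simp add: speed_def matrix_vector_mult_scaleR l1_norm_scale sum_distrib_left)

lemma speed_nonneg: "0 \<le> speed G x"
  by (simp add: speed_def sum_nonneg l1_norm_nonneg)

lemma l1_norm_le_speed: "l1_norm (G i *v x) \<le> speed G x"
  unfolding speed_def by (rule member_le_sum) (auto simp: l1_norm_nonneg)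

lemma speed_eq_0_iff: "speed G x = 0 \<longleftrightarrow> (\<forall>i. G i *v x = 0)"
proof
  assume "speed G x = 0"
  then have "norm (G i *v x) \<le> 0" for i
    using norm_le_l1_norm l1_norm_le_speed order_trans by metis
  then show "\<forall>i. G i *v x = 0" by simp
qed (simp add: speed_def l1_norm_def)

lemma continuous_on_speed: "continuous_on S (speed G)"
proof -
  have "continuous_on S (\<lambda>x. G i *v x)" for i
    by (intro linear_continuous_on bounded_linear_intros matrix_vector_mul_bounded_linear)
  then show ?thesis
    unfolding speed_def[abs_def] l1_norm_def by (intro continuous_intros)
qed

lemma generator_norm_bound:
  fixes G :: "'m::finite \<Rightarrow> real ^ 'n ^ 'n"
  obtains L where "L > 0" "\<And>i x. norm (G i *v x) \<le> L * norm x"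
proof
  let ?L = "1 + (\<Sum>i\<in>UNIV. onorm ((*v) (G i)))"
  have nonneg: "0 \<le> onorm ((*v) (G i))" for i
    by (simp add: onorm_pos_le)
  then show "?L > 0"
    by (simp add: add_pos_nonneg sum_nonneg)
  show "norm (G i *v x) \<le> ?L * norm x" for i x
  proof -
    have "onorm ((*v) (G i)) \<le> ?L"
      using member_le_sum[of i UNIV "\<lambda>i. onorm ((*v) (G i))"] nonneg by simp
    then have "onorm ((*v) (G i)) * norm x \<le> ?L * norm x"
      by (simp add: mult_right_mono)
    then show ?thesis
      using onorm[OF matrix_vector_mul_bounded_linear, of "G i" x] by linarith
  qed
qed

definition euler_matrix :: "('m \<Rightarrow> real ^ 'n ^ 'n) \<Rightarrow> real \<Rightarrow> 'm \<Rightarrow> real ^ 'n ^ 'n" where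
  "euler_matrix G h i = mat 1 + h *\<^sub>R G i"

lemma euler_matrix_mult: "euler_matrix G h i *v x = x + h *\<^sub>R (G i *v x)"
  by (simp add: euler_matrix_def matrix_vector_mult_add_rdistrib scaleR_matrix_vector_assoc)

definition euler_trajectory :: "('m \<Rightarrow> real ^ 'n ^ 'n) \<Rightarrow> real \<Rightarrow> (nat \<Rightarrow> real ^ 'n) \<Rightarrow> bool" where
  "euler_trajectory G h X \<longleftrightarrow> (\<forall>k. \<exists>i. X (Suc k) = X k + h *\<^sub>R (G i *v X k))"

lemma euler_trajectory_shift:
  "euler_trajectory G h X \<Longrightarrow> euler_trajectory G h (\<lambda>k. X (k + d))"
  by (simp add: euler_trajectory_def)

text \<open>
  Although \<open>speed G\<close> is only a seminorm, one step multiplies it by a bounded factor: a step moves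
  the state by a vector whose norm is at most \<open>\<bar>h\<bar> * speed G x\<close>, and the speed of that vector is
  at most a constant times its norm.
\<close>

lemma euler_speed_growth:
  fixes G :: "'m::finite \<Rightarrow> real ^ 'n ^ 'n"
  obtains L where "L \<ge> 1" "\<And>X k. euler_trajectory G h X \<Longrightarrow> speed G (X k) \<le> L ^ k * speed G (X 0)"
proof -
  obtain K where K: "K > 0" "\<And>i x. norm (G i *v x) \<le> K * norm x"
    using generator_norm_bound[of G] by metis
  define C where "C = real CARD('m) * (real CARD('n) * K)"
  have "0 \<le> C" using K by (simp add: C_def)
  have C: "speed G y \<le> C * l1_norm y" for y
  proof -
    have "speed G y \<le> (\<Sum>i\<in>(UNIV::'m set). real CARD('n) * (K * l1_norm y))"
      unfolding speed_def
    proof (intro sum_mono)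
      fix i
      have "l1_norm (G i *v y) \<le> real CARD('n) * (K * norm y)"
        using l1_norm_le_norm[of "G i *v y"] K(2)[of i y]
        by (meson mult_left_mono of_nat_0_le_iff order_trans)
      also have "\<dots> \<le> real CARD('n) * (K * l1_norm y)"
        using K(1) norm_le_l1_norm[of y] by (intro mult_left_mono) auto
      finally show "l1_norm (G i *v y) \<le> real CARD('n) * (K * l1_norm y)" .
    qed
    then show ?thesis by (simp add: C_def)
  qed
  let ?L = "1 + \<bar>h\<bar> * C"
  have step: "speed G (x + h *\<^sub>R (G i *v x)) \<le> ?L * speed G x" for x i
  proof -
    have "speed G (x + h *\<^sub>R (G i *v x)) \<le> speed G x + \<bar>h\<bar> * speed G (G i *v x)"
      using speed_triangle[of G x "h *\<^sub>R (G i *v x)"] by (simp add: speed_scale)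
    also have "\<dots> \<le> speed G x + \<bar>h\<bar> * (C * speed G x)"
      using C[of "G i *v x"] l1_norm_le_speed[of G i x] \<open>0 \<le> C\<close>
      by (meson abs_ge_zero add_left_mono mult_left_mono order_trans)
    finally show ?thesis by (simp add: algebra_simps)
  qed
  have "speed G (X k) \<le> ?L ^ k * speed G (X 0)" if X: "euler_trajectory G h X" for X k
  proof (induction k)
    case (Suc k)
    obtain i where "X (Suc k) = X k + h *\<^sub>R (G i *v X k)"
      using X unfolding euler_trajectory_def by blast
    then have "speed G (X (Suc k)) \<le> ?L * speed G (X k)"
      using step by simp
    also have "\<dots> \<le> ?L * (?L ^ k * speed G (X 0))"
      using Suc \<open>0 \<le> C\<close> by (intro mult_left_mono) auto
    finally show ?case by (simp add: mult.assoc)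
  qed simp
  moreover have "?L \<ge> 1" using \<open>0 \<le> C\<close> by simp
  ultimately show thesis using that by blast
qed

section \<open>From halving the speed to a Lyapunov function\<close>

definition halving_time :: "('m::finite \<Rightarrow> real ^ 'n ^ 'n) \<Rightarrow> real \<Rightarrow> nat \<Rightarrow> bool" where
  "halving_time G h N \<longleftrightarrow>
     (\<forall>X. euler_trajectory G h X \<longrightarrow> (\<exists>k\<le>N. speed G (X k) \<le> speed G (X 0) / 2))"

text \<open>
  A trajectory may halve its speed early and speed up again afterwards.  Restarting at each halving
  gives the bound \<open>L ^ N * (1/2) ^ j\<close> at every time \<open>m \<ge> j * N\<close>, where \<open>L ^ N\<close> is the possible growth
  before the next halving, and a large \<open>j\<close> makes it at most \<open>1/2\<close> at one common time.
\<close>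

lemma halving_time_imp_uniform_decay:
  assumes "halving_time G h N"
  obtains m where "\<And>X. euler_trajectory G h X \<Longrightarrow> speed G (X m) \<le> speed G (X 0) / 2"
proof -
  obtain L where L: "L \<ge> 1"
    "\<And>X k. euler_trajectory G h X \<Longrightarrow> speed G (X k) \<le> L ^ k * speed G (X 0)"
    using euler_speed_growth[of G h] by metis
  have hit: "\<exists>k\<le>N. speed G (X k) \<le> speed G (X 0) / 2" if "euler_trajectory G h X" for X
    using assms that unfolding halving_time_def by blast
  have bounded: "speed G (X m) \<le> L ^ N * speed G (X 0)" if "euler_trajectory G h X" for X m
    using that
  proof (induction m arbitrary: X rule: less_induct)
    case (less m)
    obtain k where k: "k \<le> N" "speed G (X k) \<le> speed G (X 0) / 2"
      using hit[OF less.prems] by blast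
    show ?case
    proof (cases "m \<le> N")
      case True
      then have "L ^ m \<le> L ^ N"
        using L(1) by (simp add: power_increasing)
      then show ?thesis
        using L(2)[OF less.prems, of m] speed_nonneg[of G "X 0"]
        by (meson mult_right_mono order_trans)
    next
      case False
      show ?thesis
      \<comment> \<open>A halving at time 0 makes no progress, but it means that the speed is 0.\<close>
      proof (cases "k = 0")
        case True
        then have "speed G (X 0) = 0"
          using k speed_nonneg[of G "X 0"] by simp
        then show ?thesis
          using L(2)[OF less.prems, of m] by simp
      next
        case k0: False
        then have "speed G (X ((m - k) + k)) \<le> L ^ N * speed G (X (0 + k))"
          using less.IH[of "m - k" "\<lambda>j. X (j + k)"] less.prems False
          by (simp add: euler_trajectory_shift)
        also have "\<dots> \<le> L ^ N * speed G (X 0)"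
          using k speed_nonneg[of G "X 0"] L(1) by (intro mult_left_mono) auto
        finally show ?thesis
          using False k(1) by simp
      qed
    qed
  qed
  have decay: "speed G (X m) \<le> L ^ N * (1/2) ^ j * speed G (X 0)"
    if "euler_trajectory G h X" "m \<ge> j * N" for X m j
    using that
  proof (induction j arbitrary: X m)
    case 0
    then show ?case using bounded by simp
  next
    case (Suc j)
    obtain k where k: "k \<le> N" "speed G (X k) \<le> speed G (X 0) / 2"
      using hit[OF Suc.prems(1)] by blast
    have "m - k \<ge> j * N" "k \<le> m"
      using k(1) Suc.prems(2) by auto
    then have "speed G (X m) \<le> L ^ N * (1/2) ^ j * speed G (X k)"
      using Suc.IH[of "\<lambda>i. X (i + k)" "m - k"] Suc.prems(1)
      by (simp add: euler_trajectory_shift)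
    also have "\<dots> \<le> L ^ N * (1/2) ^ j * (speed G (X 0) / 2)"
      using k(2) L(1) by (intro mult_left_mono) auto
    finally show ?case by (simp add: algebra_simps)
  qed
  obtain j where j: "(1/2::real) ^ j < 1 / (2 * L ^ N)"
    using real_arch_pow_inv[of "1 / (2 * L ^ N)" "1/2"] L(1) by auto
  have "L ^ N * (1/2) ^ j \<le> 1/2"
    using j L(1) by (simp add: field_simps)
  then have "speed G (X (j * N)) \<le> speed G (X 0) / 2" if "euler_trajectory G h X" for X
    using decay[OF that, of j "j * N"] speed_nonneg[of G "X 0"]
      mult_right_mono[of "L ^ N * (1/2) ^ j" "1/2" "speed G (X 0)"]
    by linarith
  then show thesis using that by blast
qed

primrec worst_speed :: "('m::finite \<Rightarrow> real ^ 'n ^ 'n) \<Rightarrow> real \<Rightarrow> nat \<Rightarrow> real ^ 'n \<Rightarrow> real" where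
  "worst_speed G h 0 = speed G"
| "worst_speed G h (Suc k) = (\<lambda>x. MAX i. worst_speed G h k (euler_matrix G h i *v x))"

lemma max_linear_worst_speed: "max_linear (worst_speed G h k)"
proof (induction k)
  case 0
  then show ?case by (simp add: max_linear_speed)
next
  case (Suc k)
  then show ?case
    unfolding worst_speed.simps by (intro max_linear_Max max_linear_compose_matrix)
qed

lemma worst_speed_attained: "\<exists>X. euler_trajectory G h X \<and> X 0 = x \<and> worst_speed G h k x = speed G (X k)"
proof (induction k arbitrary: x)
  case 0
  have "euler_trajectory G h (\<lambda>k. ((*v) (euler_matrix G h i) ^^ k) x)" for i
    by (auto simp: euler_trajectory_def euler_matrix_mult)
  then show ?case
    by (intro exI[of _ "\<lambda>k. ((*v) (euler_matrix G h undefined) ^^ k) x"]) simp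
next
  case (Suc k)
  have "worst_speed G h (Suc k) x \<in> range (\<lambda>i. worst_speed G h k (euler_matrix G h i *v x))"
    by (auto intro!: Max_in)
  then obtain i where i: "worst_speed G h (Suc k) x = worst_speed G h k (euler_matrix G h i *v x)"
    by blast
  obtain X where X: "euler_trajectory G h X" "X 0 = euler_matrix G h i *v x"
    "worst_speed G h k (euler_matrix G h i *v x) = speed G (X k)"
    using Suc by blast
  have "\<exists>j. (case_nat x X) (Suc l) = (case_nat x X) l + h *\<^sub>R (G j *v (case_nat x X) l)" for l
    using X(1,2) by (cases l) (auto simp: euler_trajectory_def euler_matrix_mult)
  then have "euler_trajectory G h (case_nat x X)"
    unfolding euler_trajectory_def by blast
  then show ?case
    using X(3) i by (intro exI[of _ "case_nat x X"]) simp
qed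

text \<open>
  The function is \<open>l1_norm x + 2 * h * S x\<close>, where \<open>S x\<close> sums the worst speeds after \<open>0, ..., m - 1\<close>
  steps.  A step replaces the first summand, \<open>speed G x\<close>, by the worst speed after \<open>m\<close> steps,
  which is at most half of it; the factor \<open>2 * h\<close> makes this gain match the growth of the norm.
\<close>

theorem euler_Lyapunov_function:
  assumes "h > 0" "halving_time G h N"
  shows "\<exists>V. max_linear V \<and> positive_definite V \<and>
               (\<forall>i x. V (x + h *\<^sub>R (G i *v x)) \<le> V x)"
proof -
  obtain m where m: "\<And>X. euler_trajectory G h X \<Longrightarrow> speed G (X m) \<le> speed G (X 0) / 2"
    using halving_time_imp_uniform_decay[OF assms(2)] by blast
  have half: "worst_speed G h m x \<le> speed G x / 2" for x
    using worst_speed_attained[of G h x m] m by metis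
  define S where "S x = (\<Sum>k<m. worst_speed G h k x)" for x
  define V where "V x = l1_norm x + 2 * h * S x" for x
  have "worst_speed G h k x \<ge> 0" for k x
    using worst_speed_attained[of G h x k] speed_nonneg by metis
  then have S_nonneg: "S x \<ge> 0" for x
    by (simp add: S_def sum_nonneg)
  have "max_linear V"
    unfolding V_def[abs_def] S_def[abs_def] using assms(1)
    by (intro max_linear_add max_linear_l1_norm max_linear_scale max_linear_sum
        max_linear_worst_speed) simp
  moreover have "positive_definite V"
    unfolding positive_definite_def
  proof (intro conjI allI impI)
    show "V 0 = 0"
      using max_linearE[OF \<open>max_linear V\<close>] by (metis inner_zero_right)
    show "0 < V x" if "x \<noteq> 0" for x
      using that S_nonneg[of x] assms(1) norm_le_l1_norm[of x]
      by (simp add: V_def add_pos_nonneg less_le_trans[of 0 "norm x"])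
  qed
  moreover have "V (x + h *\<^sub>R (G i *v x)) \<le> V x" for i x
  proof -
    let ?y = "x + h *\<^sub>R (G i *v x)"
    have "worst_speed G h k ?y \<le> worst_speed G h (Suc k) x" for k
      by (auto simp: euler_matrix_mult intro!: Max_ge)
    then have "S ?y \<le> (\<Sum>k<m. worst_speed G h (Suc k) x)"
      unfolding S_def by (intro sum_mono)
    also have "\<dots> = (\<Sum>k<Suc m. worst_speed G h k x) - worst_speed G h 0 x"
      by (subst sum.lessThan_Suc_shift) simp
    also have "\<dots> = S x + worst_speed G h m x - speed G x"
      by (simp add: S_def)
    also have "\<dots> \<le> S x - speed G x / 2"
      using half[of x] by simp
    finally have "2 * h * S ?y \<le> 2 * h * (S x - speed G x / 2)"
      using assms(1) by (intro mult_left_mono) auto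
    then have "2 * h * S ?y \<le> 2 * h * S x - h * speed G x"
      by (simp add: algebra_simps)
    moreover have "l1_norm ?y \<le> l1_norm x + h * speed G x"
    proof -
      have "l1_norm ?y \<le> l1_norm x + h * l1_norm (G i *v x)"
        using l1_norm_triangle[of x "h *\<^sub>R (G i *v x)"] assms(1) by (simp add: l1_norm_scale)
      moreover have "h * l1_norm (G i *v x) \<le> h * speed G x"
        using assms(1) l1_norm_le_speed[of G i x] by simp
      ultimately show ?thesis by linarith
    qed
    ultimately show ?thesis
      by (simp add: V_def)
  qed
  ultimately show ?thesis by blast
qed

section \<open>Convex combinations of the generators\<close>

lemma comb_mult: "comb G w *v x = (\<Sum>i\<in>UNIV. w $ i *\<^sub>R (G i *v x))"
proof -
  have *: "(\<Sum>i\<in>I. w $ i *\<^sub>R G i) *v x = (\<Sum>i\<in>I. w $ i *\<^sub>R (G i *v x))" for I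
    by (induction I rule: infinite_finite_induct)
      (simp_all add: matrix_vector_mult_add_rdistrib scaleR_matrix_vector_assoc)
  show ?thesis
    unfolding comb_def by (rule *)
qed

lemma comb_axis: "comb G (axis i 1) *v x = G i *v x"
proof -
  have "comb G (axis i 1) *v x = (\<Sum>j\<in>UNIV. if j = i then G j *v x else 0)"
    unfolding comb_mult by (intro sum.cong refl) (auto simp: axis_def)
  then show ?thesis by simp
qed

lemma axis_in_weights: "axis i 1 \<in> weights"
  by (simp add: weights_def axis_def)

lemma comb_minus_identity:
  assumes "w \<in> weights"
  shows "comb A w *v x = x + comb (\<lambda>i. A i - mat 1) w *v x"
proof -
  have "(\<Sum>i\<in>UNIV. w $ i *\<^sub>R x) = x"
    using assms by (simp add: weights_def flip: scaleR_left.sum)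
  then show ?thesis
    by (simp add: comb_mult matrix_vector_mult_diff_rdistrib scaleR_diff_right sum_subtractf)
qed

lemma norm_comb_le:
  assumes "\<And>i. 0 \<le> w $ i" "\<And>i. norm (G i *v x) \<le> B"
  shows "norm (comb G w *v x) \<le> (\<Sum>i\<in>UNIV. w $ i) * B"
proof -
  have "norm (comb G w *v x) \<le> (\<Sum>i\<in>UNIV. norm (w $ i *\<^sub>R (G i *v x)))"
    unfolding comb_mult by (rule norm_sum)
  also have "\<dots> \<le> (\<Sum>i\<in>UNIV. w $ i * B)"
    using assms by (intro sum_mono) (simp add: mult_left_mono)
  finally show ?thesis
    by (simp add: sum_distrib_right)
qed

lemma euler_decrease_comb:
  assumes "max_linear V" "\<And>i x. V (x + h *\<^sub>R (G i *v x)) \<le> V x" "w \<in> weights"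
  shows "V (x + h *\<^sub>R (comb G w *v x)) \<le> V x"
proof -
  have w: "(\<Sum>i\<in>UNIV. w $ i) = 1" "\<And>i. 0 \<le> w $ i"
    using assms(3) by (auto simp: weights_def)
  have "x + h *\<^sub>R (comb G w *v x) = (\<Sum>i\<in>UNIV. w $ i *\<^sub>R (x + h *\<^sub>R (G i *v x)))"
  proof -
    have "(\<Sum>i\<in>UNIV. w $ i *\<^sub>R x) = x"
      using w by (simp flip: scaleR_left.sum)
    then show ?thesis
      by (simp add: comb_mult scaleR_add_right sum.distrib scaleR_sum_right mult.commute)
  qed
  then have "V (x + h *\<^sub>R (comb G w *v x)) \<le> (\<Sum>i\<in>UNIV. w $ i * V (x + h *\<^sub>R (G i *v x)))"
    using w by (simp only:) (rule max_linear_sublinear[OF assms(1)], simp)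
  also have "\<dots> \<le> (\<Sum>i\<in>UNIV. w $ i * V x)"
    using assms(2) w by (intro sum_mono mult_left_mono) auto
  also have "\<dots> = V x"
    using w by (simp flip: sum_distrib_right)
  finally show ?thesis .
qed

text \<open>
  For \<open>t < h\<close> the point \<open>x + t y\<close> lies between \<open>x\<close> and \<open>x + h y\<close>, so by convexity the difference
  quotients are nonpositive for all small \<open>t\<close>.
\<close>

lemma euler_decrease_imp_Dini:
  assumes V: "max_linear V" and "h > 0" and le: "V (x + h *\<^sub>R y) \<le> V x"
  shows "Limsup (at_right 0) (\<lambda>t. ereal ((V (x + t *\<^sub>R y) - V x) / t)) \<le> 0"
proof (rule Limsup_bounded)
  have "(V (x + t *\<^sub>R y) - V x) / t \<le> 0" if "0 < t" "t < h" for t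
  proof -
    \<comment> \<open>The convex combination of two points, indexed by the booleans.\<close>
    define c :: "bool \<Rightarrow> real" where "c b = (if b then t / h else 1 - t / h)" for b
    have c: "0 \<le> c b" for b
      using that by (simp add: c_def)
    have "x + t *\<^sub>R y = (\<Sum>b\<in>UNIV. c b *\<^sub>R (if b then x + h *\<^sub>R y else x))"
      using that by (simp add: UNIV_bool c_def algebra_simps)
    then have "V (x + t *\<^sub>R y) \<le> (\<Sum>b\<in>UNIV. c b * V (if b then x + h *\<^sub>R y else x))"
      by (simp only:) (rule max_linear_sublinear[OF V c])
    also have "\<dots> = (1 - t / h) * V x + t / h * V (x + h *\<^sub>R y)"
      by (simp add: UNIV_bool c_def)
    also have "\<dots> \<le> (1 - t / h) * V x + t / h * V x"
      using le that by (intro add_left_mono mult_left_mono) auto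
    finally show ?thesis
      using that by (simp add: algebra_simps divide_nonpos_pos)
  qed
  then show "\<forall>\<^sub>F t in at_right 0. ereal ((V (x + t *\<^sub>R y) - V x) / t) \<le> 0"
    unfolding eventually_at_right_field using \<open>h > 0\<close>
    by (intro exI[of _ h]) (auto simp: zero_ereal_def)
qed

lemma halving_time_imp_Lyapunov_dt:
  fixes A :: "'m::finite \<Rightarrow> real ^ 'n ^ 'n"
  assumes "halving_time (\<lambda>i. A i - mat 1) 1 N"
  shows "\<exists>V. weak_polyhedral_Lyapunov_dt A V"
proof -
  obtain V where V: "max_linear V" "positive_definite V"
    "\<And>i x. V (x + 1 *\<^sub>R ((A i - mat 1) *v x)) \<le> V x"
    using euler_Lyapunov_function[OF zero_less_one assms] by auto
  have "V (comb A w *v x) \<le> V x" if w: "w \<in> weights" for w x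
  proof -
    let ?G = "\<lambda>i. A i - mat 1"
    have "V (x + 1 *\<^sub>R (comb ?G w *v x)) \<le> V x"
      by (rule euler_decrease_comb[OF V(1) _ w]) (rule V(3))
    then show ?thesis
      by (simp only: comb_minus_identity[OF w, of A] scaleR_one)
  qed
  with V show ?thesis
    unfolding weak_polyhedral_Lyapunov_dt_def weak_Lyapunov_dt_def
    by (blast intro: max_linear_imp_polyhedral)
qed

lemma halving_time_imp_Lyapunov_ct:
  fixes A :: "'m::finite \<Rightarrow> real ^ 'n ^ 'n"
  assumes "h > 0" "halving_time A h N"
  shows "\<exists>V. weak_polyhedral_Lyapunov_ct A V"
proof -
  obtain V where V: "max_linear V" "positive_definite V"
    "\<And>i x. V (x + h *\<^sub>R (A i *v x)) \<le> V x"
    using euler_Lyapunov_function[OF assms] by auto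
  have "Limsup (at_right 0) (\<lambda>t. ereal ((V (x + t *\<^sub>R (comb A w *v x)) - V x) / t)) \<le> 0"
    if "w \<in> weights" for w x
    by (rule euler_decrease_imp_Dini[OF V(1) assms(1)], rule euler_decrease_comb[OF V(1) _ that])
       (rule V(3))
  with V show ?thesis
    unfolding weak_polyhedral_Lyapunov_ct_def weak_Lyapunov_ct_def
    by (blast intro: max_linear_imp_polyhedral)
qed

section \<open>Normalised trajectories that never halve their speed\<close>

text \<open>
  On the orthogonal complement of the common kernel the generators are jointly injective, hence
  bounded below; this bounds the component of \<open>x\<close> in the complement by the speed of \<open>x\<close>.
\<close>

lemma distance_to_equilibria:
  fixes G :: "'m::finite \<Rightarrow> real ^ 'n ^ 'n"
  obtains R where "R > 0"
    "\<And>x. \<exists>y. (\<forall>i. G i *v y = 0) \<and> norm (x - y) \<le> R * speed G x"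
proof -
  define K where "K = {y. \<forall>i. G i *v y = 0}"
  define S where "S = {z. \<forall>y\<in>K. orthogonal y z}"
  define f :: "real ^ 'n \<Rightarrow> (real ^ 'n) ^ 'm" where "f x = (\<chi> i. G i *v x)" for x
  have K: "subspace K"
    by (auto simp: K_def subspace_def matrix_vector_right_distrib matrix_vector_mult_scaleR)
  have S: "subspace S"
    unfolding S_def by (rule subspace_orthogonal_to_vectors)
  have "linear f"
    by (rule linearI)
      (simp_all add: f_def vec_eq_iff matrix_vector_right_distrib matrix_vector_mult_scaleR)
  then have "bounded_linear f"
    by (rule linear_conv_bounded_linear[THEN iffD1])
  moreover have "x = 0" if "x \<in> S" "f x = 0" for x
  proof -
    have "x \<in> K"
      using that(2) by (simp add: K_def f_def vec_eq_iff)
    then show ?thesis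
      using that(1) orthogonal_self unfolding S_def by blast
  qed
  ultimately obtain e where e: "e > 0" "\<And>x. x \<in> S \<Longrightarrow> e * norm x \<le> norm (f x)"
    using injective_imp_isometric[of S f] S closed_subspace by blast
  have norm_f: "norm (f x) \<le> speed G x" for x
  proof -
    have "norm (f x) \<le> (\<Sum>i\<in>UNIV. norm (G i *v x))"
      unfolding norm_vec_def f_def by (simp add: L2_set_le_sum)
    also have "\<dots> \<le> speed G x"
      unfolding speed_def by (intro sum_mono norm_le_l1_norm)
    finally show ?thesis .
  qed
  show thesis
  proof
    show "1 / e > 0"
      using e by simp
    fix x
    obtain y z where yz: "y \<in> span K" "\<And>v. v \<in> span K \<Longrightarrow> orthogonal z v" "x = y + z"
      using orthogonal_subspace_decomp_exists[of K x] by blast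
    have "y \<in> K"
      using yz(1) K by (simp add: span_eq_iff[THEN iffD2])
    then have "f z = f x"
      using yz(3) by (simp add: K_def f_def matrix_vector_right_distrib)
    moreover have "z \<in> S"
      using yz(2) by (auto simp: S_def orthogonal_commute span_base)
    ultimately have "e * norm z \<le> speed G x"
      using e(2)[of z] norm_f[of x] by simp
    then have "norm (x - y) \<le> 1 / e * speed G x"
      using e(1) yz(3) by (simp add: field_simps)
    then show "\<exists>y. (\<forall>i. G i *v y = 0) \<and> norm (x - y) \<le> 1 / e * speed G x"
      using \<open>y \<in> K\<close> by (auto simp: K_def)
  qed
qed

text \<open>
  Subtracting an equilibrium and scaling turn Euler trajectories into Euler trajectories.  Any
  violation of the halving property can thus be moved into one compact set of initial states, with
  initial speed 1.  The radius depends on neither \<open>h\<close> nor \<open>N\<close>, which is what the limit of small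
  steps requires.
\<close>

lemma normalised_fast_trajectories:
  fixes G :: "'m::finite \<Rightarrow> real ^ 'n ^ 'n"
  obtains R where "R > 0"
    "\<And>h N. \<not> halving_time G h N \<Longrightarrow>
       \<exists>X. euler_trajectory G h X \<and> norm (X 0) \<le> R \<and> (\<forall>k\<le>N. 1/2 \<le> speed G (X k))"
proof -
  obtain R where R: "R > 0"
    "\<And>x. \<exists>y. (\<forall>i. G i *v y = 0) \<and> norm (x - y) \<le> R * speed G x"
    using distance_to_equilibria[of G] by blast
  have "\<exists>X. euler_trajectory G h X \<and> norm (X 0) \<le> R \<and> (\<forall>k\<le>N. 1/2 \<le> speed G (X k))"
    if bad: "\<not> halving_time G h N" for h N
  proof -
    obtain X where X: "euler_trajectory G h X" "\<And>k. k \<le> N \<Longrightarrow> speed G (X k) > speed G (X 0) / 2"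
      using bad unfolding halving_time_def by (meson not_le)
    obtain y where y: "\<And>i. G i *v y = 0" "norm (X 0 - y) \<le> R * speed G (X 0)"
      using R(2) by blast
    have pos: "speed G (X 0) > 0"
      using X(2)[of 0] by simp
    define c where "c = 1 / speed G (X 0)"
    define Y where "Y k = c *\<^sub>R (X k - y)" for k
    have GY: "G i *v Y k = c *\<^sub>R (G i *v X k)" for i k
      by (simp add: Y_def matrix_vector_mult_scaleR matrix_vector_mult_diff_distrib y)
    have "euler_trajectory G h Y"
      unfolding euler_trajectory_def
    proof
      fix k
      obtain i where "X (Suc k) = X k + h *\<^sub>R (G i *v X k)"
        using X(1) unfolding euler_trajectory_def by blast
      then have "Y (Suc k) = Y k + h *\<^sub>R (G i *v Y k)"
        unfolding GY by (simp add: Y_def algebra_simps)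
      then show "\<exists>i. Y (Suc k) = Y k + h *\<^sub>R (G i *v Y k)" ..
    qed
    moreover have "norm (Y 0) \<le> R"
      using y(2) pos by (simp add: Y_def c_def divide_le_eq del: scaleR_diff_right scaleR_right_diff_distrib)
    moreover have "1/2 \<le> speed G (Y k)" if "k \<le> N" for k
    proof -
      have "speed G (Y k) = c * speed G (X k)"
        using pos by (simp add: speed_def[of G "Y k"] speed_def[of G "X k"] GY l1_norm_scale
            c_def sum_distrib_left)
      then show ?thesis
        using X(2)[OF that] pos by (simp add: c_def pos_le_divide_eq)
    qed
    ultimately show ?thesis by blast
  qed
  with R(1) show thesis using that by blast
qed

text \<open>
  Tychonoff's theorem for the topology of pointwise convergence.
\<close>

lemma compact_dependent_functions:
  fixes S :: "'i \<Rightarrow> 'b::topological_space set"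
  assumes "\<And>t. compact (S t)"
  shows "compact {g. \<forall>t. g t \<in> S t}"
proof -
  have "compactin (product_topology (\<lambda>t. euclidean) UNIV) (PiE UNIV S)"
    using assms by (simp add: compactin_PiE)
  moreover have "PiE UNIV S = {g. \<forall>t. g t \<in> S t}"
    by (auto simp: PiE_def)
  ultimately show ?thesis
    by (simp add: euclidean_product_topology)
qed

lemma compact_decreasing_closed:
  fixes C :: "nat \<Rightarrow> 'a::topological_space set"
  assumes "compact K" "\<And>n. closed (C n)" "decseq C" "\<And>n. K \<inter> C n \<noteq> {}"
  obtains x where "x \<in> K" "\<And>n. x \<in> C n"
proof -
  have "K \<inter> (\<Inter>n\<in>UNIV. C n) \<noteq> {}"
  proof (rule compact_imp_fip_image[OF assms(1,2)])
    fix I :: "nat set"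
    assume "finite I"
    then have "C (Max (insert 0 I)) \<subseteq> C n" if "n \<in> I" for n
      using that by (intro decseqD[OF assms(3)] Max_ge) auto
    then show "K \<inter> (\<Inter>n\<in>I. C n) \<noteq> {}"
      using assms(4)[of "Max (insert 0 I)"] by blast
  qed
  then show thesis using that by blast
qed

lemma euler_trajectory_norm_bound:
  assumes "euler_trajectory G h X" "0 \<le> h" "\<And>i x. norm (G i *v x) \<le> L * norm x" "0 \<le> L"
  shows "norm (X k) \<le> (1 + h * L) ^ k * norm (X 0)"
proof (induction k)
  case (Suc k)
  obtain i where "X (Suc k) = X k + h *\<^sub>R (G i *v X k)"
    using assms(1) unfolding euler_trajectory_def by blast
  then have "norm (X (Suc k)) \<le> norm (X k) + h * norm (G i *v X k)"
    using norm_triangle_ineq[of "X k" "h *\<^sub>R (G i *v X k)"] assms(2) by simp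
  also have "\<dots> \<le> norm (X k) + h * (L * norm (X k))"
    using assms(2,3) by (intro add_left_mono mult_left_mono) auto
  also have "\<dots> = (1 + h * L) * norm (X k)"
    by (simp add: algebra_simps)
  also have "\<dots> \<le> (1 + h * L) * ((1 + h * L) ^ k * norm (X 0))"
    using Suc assms(2,4) by (intro mult_left_mono) auto
  finally show ?case by (simp add: mult.assoc)
qed simp

section \<open>Discrete time\<close>

text \<open>
  Being a trajectory, and being fast up to time \<open>N\<close>, are closed conditions for pointwise
  convergence, and trajectories from a fixed ball lie in a compact product of balls.
\<close>

lemma infinite_fast_trajectory:
  fixes G :: "'m::finite \<Rightarrow> real ^ 'n ^ 'n"
  assumes "0 \<le> h" "\<And>N. \<not> halving_time G h N"
  obtains X where "euler_trajectory G h X" "\<And>k. 1/2 \<le> speed G (X k)"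
proof -
  obtain R where R: "R > 0"
    "\<And>h N. \<not> halving_time G h N \<Longrightarrow>
       \<exists>X. euler_trajectory G h X \<and> norm (X 0) \<le> R \<and> (\<forall>k\<le>N. 1/2 \<le> speed G (X k))"
    using normalised_fast_trajectories[of G] by blast
  obtain L where L: "L > 0" "\<And>i x. norm (G i *v x) \<le> L * norm x"
    using generator_norm_bound[of G] by blast
  define K where "K = {X :: nat \<Rightarrow> real ^ 'n. \<forall>k. X k \<in> cball 0 ((1 + h * L) ^ k * R)}"
  define C where "C N = {X. euler_trajectory G h X \<and> (\<forall>k. k \<le> N \<longrightarrow> 1/2 \<le> speed G (X k))}" for N
  have "compact K"
    unfolding K_def by (rule compact_dependent_functions) simp
  moreover have "closed (C N)" for N
  proof -
    have coord: "continuous_on UNIV (\<lambda>X::nat \<Rightarrow> real ^ 'n. X k)" for k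
      by simp
    have "{X. euler_trajectory G h X} = (\<Inter>k. \<Union>i. {X. X (Suc k) = X k + h *\<^sub>R (G i *v X k)})"
      by (auto simp: euler_trajectory_def)
    moreover have "closed {X. X (Suc k) = X k + h *\<^sub>R (G i *v X k)}" for k i
      by (intro closed_Collect_eq continuous_intros coord
          bounded_linear.continuous_on[OF matrix_vector_mul_bounded_linear])
    ultimately have "closed {X. euler_trajectory G h X}"
      by (auto intro!: closed_INT closed_UN)
    moreover have "closed {X :: nat \<Rightarrow> real ^ 'n. 1/2 \<le> speed G (X k)}" for k
      by (intro closed_Collect_le continuous_intros
          continuous_on_compose2[OF continuous_on_speed[of UNIV] coord]) auto
    ultimately show ?thesis
      unfolding C_def
      by (intro closed_Collect_conj closed_Collect_all closed_Collect_imp open_Collect_const)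
  qed
  moreover have "decseq C"
    by (auto simp: decseq_def C_def)
  moreover have "K \<inter> C N \<noteq> {}" for N
  proof -
    obtain X where X: "euler_trajectory G h X" "norm (X 0) \<le> R" "\<And>k. k \<le> N \<Longrightarrow> 1/2 \<le> speed G (X k)"
      using R(2)[OF assms(2)[of N]] by blast
    have "norm (X k) \<le> (1 + h * L) ^ k * R" for k
    proof -
      have "(1 + h * L) ^ k * norm (X 0) \<le> (1 + h * L) ^ k * R"
        using X(2) assms(1) L(1) by (intro mult_left_mono) auto
      then show ?thesis
        using euler_trajectory_norm_bound[OF X(1) assms(1) L(2), of k] L(1) by linarith
    qed
    then show ?thesis
      using X by (auto simp: K_def C_def)
  qed
  ultimately obtain X where "\<And>N. X \<in> C N"
    using compact_decreasing_closed[of K C] by blast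
  then show thesis
    by (intro that) (auto simp: C_def)
qed

lemma strongly_convergent_dt_imp_halving_time:
  fixes A :: "'m::finite \<Rightarrow> real ^ 'n ^ 'n"
  assumes "strongly_convergent_dt A"
  shows "\<exists>N. halving_time (\<lambda>i. A i - mat 1) 1 N"
proof (rule ccontr)
  let ?G = "\<lambda>i. A i - mat 1"
  assume "\<not> ?thesis"
  then obtain X where X: "euler_trajectory ?G 1 X" "\<And>k. 1/2 \<le> speed ?G (X k)"
    using infinite_fast_trajectory[of 1 ?G] by auto
  obtain i where i: "\<And>k. X (Suc k) = X k + (A (i k) - mat 1) *v X k"
    using X(1) unfolding euler_trajectory_def by (metis scaleR_one)
  have "solution_dt A (\<lambda>k. axis (i k) 1) X"
    unfolding solution_dt_def comb_axis by (simp add: i matrix_vector_mult_diff_rdistrib)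
  then obtain xbar where xbar: "xbar \<in> equilibria_dt A" "X \<longlonglongrightarrow> xbar"
    using assms[unfolded strongly_convergent_dt_def, rule_format, OF axis_in_weights] by blast
  have "isCont (speed ?G) xbar"
    using continuous_on_speed[of UNIV ?G] by (simp add: continuous_on_eq_continuous_at)
  then have "(\<lambda>k. speed ?G (X k)) \<longlonglongrightarrow> speed ?G xbar"
    by (rule isCont_tendsto_compose) (rule xbar(2))
  moreover have "speed ?G xbar = 0"
    using xbar(1) by (simp add: speed_eq_0_iff equilibria_dt_def matrix_ker_def)
  ultimately show False
    using X(2) LIMSEQ_le_const[of _ 0 "1/2"] by fastforce
qed

section \<open>Limits of Euler trajectories in continuous time\<close>

text \<open>
  Multiplied by the step, this is the integral of the switching signal \<open>c\<close>; unlike the signals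
  themselves, the integrals accumulate pointwise as the step tends to 0.
\<close>

definition occupation :: "(nat \<Rightarrow> 'm::finite) \<Rightarrow> nat \<Rightarrow> real ^ 'm" where
  "occupation c k = (\<Sum>j<k. axis (c j) 1)"

lemma occupation_diff: "a \<le> b \<Longrightarrow> occupation c b - occupation c a = (\<Sum>j\<in>{a..<b}. axis (c j) 1)"
  unfolding occupation_def by (simp add: atLeast0LessThan[symmetric] sum_diff_nat_ivl)

lemma occupation_mono:
  assumes "a \<le> b"
  shows "occupation c a $ i \<le> occupation c b $ i"
proof -
  have "0 \<le> (\<Sum>j\<in>{a..<b}. axis (c j) (1::real)) $ i"
    by (simp add: axis_def sum_nonneg)
  then show ?thesis
    by (simp only: occupation_diff[OF assms, symmetric] vector_minus_component diff_ge_0_iff_ge)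
qed

lemma sum_occupation: "(\<Sum>i\<in>UNIV. occupation c k $ i) = real k"
proof -
  have "(\<Sum>i\<in>UNIV. occupation c k $ i) = (\<Sum>j<k. \<Sum>i\<in>UNIV. axis (c j) 1 $ i)"
    unfolding occupation_def sum_component by (rule sum.swap)
  then show ?thesis by (simp add: axis_def)
qed

lemma norm_occupation: "norm (occupation c k) \<le> real k"
proof -
  have "norm (occupation c k) \<le> (\<Sum>j<k. norm (axis (c j) 1 :: real ^ 'a))"
    unfolding occupation_def by (rule norm_sum)
  then show ?thesis by (simp add: norm_axis_1)
qed

lemma comb_occupation_diff:
  assumes "a \<le> b"
  shows "comb G (occupation c b - occupation c a) *v y = (\<Sum>j\<in>{a..<b}. G (c j) *v y)"
proof -
  have "comb G (\<Sum>j\<in>J. axis (c j) 1) *v y = (\<Sum>j\<in>J. G (c j) *v y)" for J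
  proof (induction J rule: infinite_finite_induct)
    case (insert j J)
    have "comb G (u + v) *v y = comb G u *v y + comb G v *v y" for u v
      by (simp add: comb_mult scaleR_add_left sum.distrib)
    with insert show ?case by (simp add: comb_axis)
  qed (simp_all add: comb_mult)
  then show ?thesis
    using assms by (simp add: occupation_diff)
qed

text \<open>
  The increment is the sum of \<open>h G (c j) (X j)\<close> over the steps.  Replacing every \<open>X j\<close> by \<open>X a\<close>
  leaves only the occupation numbers, and costs an error of second order because \<open>X j - X a\<close> is
  itself bounded by a multiple of the elapsed time.
\<close>

lemma euler_second_order_error:
  assumes X: "\<And>k. X (Suc k) = X k + h *\<^sub>R (G (c k) *v X k)"
    and h: "0 \<le> h" and L: "\<And>i x. norm (G i *v x) \<le> L * norm x" "0 \<le> L"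
    and B: "\<And>j. j \<le> b \<Longrightarrow> norm (X j) \<le> B" and ab: "a \<le> b"
  shows "norm (X b - X a - comb G (h *\<^sub>R (occupation c b - occupation c a)) *v X a)
           \<le> L\<^sup>2 * B * (h * real (b - a))\<^sup>2"
proof -
  have B0: "0 \<le> B"
    using B[of 0] norm_ge_zero order_trans by blast
  have incr: "X d - X a = (\<Sum>j\<in>{a..<d}. h *\<^sub>R (G (c j) *v X j))" if "a \<le> d" for d
  proof -
    have "X d - X a = (\<Sum>j\<in>{a..<d}. X (Suc j) - X j)"
      using that by (simp add: sum_Suc_diff')
    then show ?thesis by (simp add: X)
  qed
  have drift: "norm (X d - X a) \<le> h * real (b - a) * L * B" if "a \<le> d" "d \<le> b" for d
  proof -
    have "norm (X d - X a) \<le> (\<Sum>j\<in>{a..<d}. norm (h *\<^sub>R (G (c j) *v X j)))"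
      unfolding incr[OF that(1)] by (rule norm_sum)
    also have "\<dots> \<le> (\<Sum>j\<in>{a..<d}. h * (L * B))"
    proof (intro sum_mono)
      fix j assume "j \<in> {a..<d}"
      then have "norm (X j) \<le> B" using B that by simp
      then have "norm (G (c j) *v X j) \<le> L * B"
        using L by (meson mult_left_mono order_trans)
      then show "norm (h *\<^sub>R (G (c j) *v X j)) \<le> h * (L * B)"
        using h by (simp add: mult_left_mono)
    qed
    also have "\<dots> = real (d - a) * (h * (L * B))"
      by simp
    also have "\<dots> \<le> real (b - a) * (h * (L * B))"
      using that h L(2) B0 by (intro mult_right_mono) auto
    finally show ?thesis by (simp add: mult_ac)
  qed
  have "comb G (h *\<^sub>R (occupation c b - occupation c a)) *v X a
      = h *\<^sub>R (comb G (occupation c b - occupation c a) *v X a)"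
    by (simp add: comb_mult scaleR_sum_right)
  also have "\<dots> = (\<Sum>j\<in>{a..<b}. h *\<^sub>R (G (c j) *v X a))"
    by (simp only: comb_occupation_diff[OF ab] scaleR_sum_right)
  finally have "X b - X a - comb G (h *\<^sub>R (occupation c b - occupation c a)) *v X a
      = (\<Sum>j\<in>{a..<b}. h *\<^sub>R (G (c j) *v (X j - X a)))"
    by (simp add: incr[OF ab] matrix_vector_mult_diff_distrib scaleR_diff_right sum_subtractf)
  then have "norm (X b - X a - comb G (h *\<^sub>R (occupation c b - occupation c a)) *v X a)
      \<le> (\<Sum>j\<in>{a..<b}. norm (h *\<^sub>R (G (c j) *v (X j - X a))))"
    by (simp only: norm_sum)
  also have "\<dots> \<le> (\<Sum>j\<in>{a..<b}. h * (L * (h * real (b - a) * L * B)))"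
  proof (intro sum_mono)
    fix j assume "j \<in> {a..<b}"
    then have "norm (X j - X a) \<le> h * real (b - a) * L * B"
      by (intro drift) auto
    then have "norm (G (c j) *v (X j - X a)) \<le> L * (h * real (b - a) * L * B)"
      using L by (meson mult_left_mono order_trans)
    then show "norm (h *\<^sub>R (G (c j) *v (X j - X a))) \<le> h * (L * (h * real (b - a) * L * B))"
      using h by (simp add: mult_left_mono)
  qed
  also have "\<dots> = L\<^sup>2 * B * (h * real (b - a))\<^sup>2"
    using ab by (simp add: power2_eq_square mult_ac of_nat_diff)
  finally show ?thesis .
qed

text \<open>
  A pair of functions \<open>(x, F)\<close>: the state, and the time that has been given to each generator.  Step
  functions coming from Euler trajectories of step \<open>h\<close> qualify when \<open>b\<close> is suitable, as do, with
  \<open>h = 0\<close>, solutions of the differential inclusion.  Each requirement concerns only two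
  times, so that it is closed under pointwise convergence; no derivative or integral occurs.
\<close>

definition relaxed_trajectory ::
  "('m::finite \<Rightarrow> real ^ 'n ^ 'n) \<Rightarrow> (real \<Rightarrow> real) \<Rightarrow> real \<Rightarrow> (real \<Rightarrow> (real ^ 'n) \<times> (real ^ 'm)) \<Rightarrow> bool"
where
  "relaxed_trajectory G b h g \<longleftrightarrow>
     (\<forall>s t. 0 \<le> s \<and> s \<le> t \<longrightarrow>
        (\<forall>i. snd (g s) $ i \<le> snd (g t) $ i) \<and>
        \<bar>(\<Sum>i\<in>UNIV. snd (g t) $ i - snd (g s) $ i) - (t - s)\<bar> \<le> h \<and>
        norm (fst (g t) - fst (g s) - comb G (snd (g t) - snd (g s)) *v fst (g s))
          \<le> b t * (t - s + h)\<^sup>2)"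

text \<open>
  The trajectory is read as a step function of time.  At negative times \<open>nat\<close> gives step 0,
  which keeps the bounds valid on the whole line.  The last two claims place the pair in a compact
  product that does not depend on \<open>h\<close>.
\<close>

lemma euler_imp_relaxed_trajectory:
  assumes X: "\<And>k. X (Suc k) = X k + h *\<^sub>R (G (c k) *v X k)"
    and h: "0 < h" and L: "\<And>i x. norm (G i *v x) \<le> L * norm x" "0 \<le> L"
    and R: "norm (X 0) \<le> R"
  defines "g \<equiv> \<lambda>t. (X (nat \<lfloor>t / h\<rfloor>), h *\<^sub>R occupation c (nat \<lfloor>t / h\<rfloor>))"
  shows "relaxed_trajectory G (\<lambda>t. L\<^sup>2 * (R * exp (L * t))) h g"
    and "norm (fst (g t)) \<le> R * exp (L * \<bar>t\<bar>)" and "norm (snd (g t)) \<le> \<bar>t\<bar>"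
proof -
  define k where "k t = nat \<lfloor>t / h\<rfloor>" for t
  have R0: "0 \<le> R" using R norm_ge_zero order_trans by blast
  have k_le: "h * real (k t) \<le> t" and k_gt: "t - h < h * real (k t)" if "0 \<le> t" for t
  proof -
    have "real (k t) = of_int \<lfloor>t / h\<rfloor>"
      using that h by (simp add: k_def)
    then have "real (k t) \<le> t / h" "t / h < real (k t) + 1"
      by linarith+
    then show "h * real (k t) \<le> t" "t - h < h * real (k t)"
      using h by (simp_all add: field_simps)
  qed
  have k_neg: "k t = 0" if "t < 0" for t
  proof -
    have "t / h < 0" using that h by (simp add: divide_neg_pos)
    then show ?thesis by (simp add: k_def)
  qed
  have "euler_trajectory G h X"
    unfolding euler_trajectory_def using X by blast
  then have bound: "norm (X j) \<le> R * exp (L * t)" if "h * real j \<le> t" for j t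
  proof -
    have "norm (X j) \<le> (1 + h * L) ^ j * norm (X 0)"
      using euler_trajectory_norm_bound[OF \<open>euler_trajectory G h X\<close> _ L] h by simp
    also have "\<dots> \<le> exp (h * L) ^ j * R"
      using R h L(2) by (intro mult_mono power_mono exp_ge_add_one_self) auto
    also have "\<dots> = R * exp (L * (h * real j))"
      by (simp add: mult_ac flip: exp_of_nat_mult)
    also have "\<dots> \<le> R * exp (L * t)"
      using that R0 L(2) by (intro mult_left_mono) (simp_all add: mult_left_mono)
    finally show ?thesis .
  qed
  show "norm (fst (g t)) \<le> R * exp (L * \<bar>t\<bar>)"
    using bound[of "k t" "\<bar>t\<bar>"] k_le[of t] k_neg[of t] by (cases "t < 0") (auto simp: g_def k_def)
  show "norm (snd (g t)) \<le> \<bar>t\<bar>"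
  proof -
    have "norm (snd (g t)) \<le> h * real (k t)"
      using norm_occupation[of c "k t"] h by (simp add: g_def k_def mult_left_mono)
    then show ?thesis
      using k_le[of t] k_neg[of t] by (cases "t < 0") auto
  qed
  show "relaxed_trajectory G (\<lambda>t. L\<^sup>2 * (R * exp (L * t))) h g"
    unfolding relaxed_trajectory_def
  proof (intro allI impI, elim conjE)
    fix s t :: real
    assume st: "0 \<le> s" "s \<le> t"
    \<comment> \<open>The step count \<open>k t\<close> satisfies \<open>t - h < h * k t \<le> t\<close>, whence every error \<open>h\<close> below.\<close>
    have kk: "k s \<le> k t"
      unfolding k_def using st h by (intro nat_mono floor_mono divide_right_mono) auto
    have "h * real (k t - k s) = h * real (k t) - h * real (k s)"
      using kk by (simp add: of_nat_diff right_diff_distrib)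
    then have len: "0 \<le> h * real (k t - k s)" "h * real (k t - k s) \<le> t - s + h"
      using k_le[of t] k_gt[of s] st h mult_nonneg_nonneg[of h "real (k t - k s)"] by linarith+
    have mono: "snd (g s) $ i \<le> snd (g t) $ i" for i
      using occupation_mono[OF kk, of c i] h by (simp add: g_def k_def)
    have "(\<Sum>i\<in>UNIV. snd (g t) $ i - snd (g s) $ i) = h * real (k t) - h * real (k s)"
      by (simp add: g_def sum_subtractf sum_occupation flip: k_def sum_distrib_left)
    then have time: "\<bar>(\<Sum>i\<in>UNIV. snd (g t) $ i - snd (g s) $ i) - (t - s)\<bar> \<le> h"
      using k_le[of t] k_gt[of t] k_le[of s] k_gt[of s] st by auto
    have "norm (fst (g t) - fst (g s) - comb G (snd (g t) - snd (g s)) *v fst (g s))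
        \<le> L\<^sup>2 * (R * exp (L * t)) * (h * real (k t - k s))\<^sup>2"
    proof -
      have "norm (X j) \<le> R * exp (L * t)" if "j \<le> k t" for j
      proof -
        have "h * real j \<le> h * real (k t)"
          using that h by simp
        then show ?thesis
          using bound k_le[of t] st by force
      qed
      then show ?thesis
        using euler_second_order_error[where X = X and h = h and G = G and c = c and L = L
            and a = "k s" and b = "k t" and B = "R * exp (L * t)"] X h L kk
        by (simp add: g_def scaleR_diff_right flip: k_def)
    qed
    also have "\<dots> \<le> L\<^sup>2 * (R * exp (L * t)) * (t - s + h)\<^sup>2"
      using len R0 by (intro mult_left_mono power_mono) auto
    finally show "(\<forall>i. snd (g s) $ i \<le> snd (g t) $ i) \<and>
        \<bar>(\<Sum>i\<in>UNIV. snd (g t) $ i - snd (g s) $ i) - (t - s)\<bar> \<le> h \<and>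
        norm (fst (g t) - fst (g s) - comb G (snd (g t) - snd (g s)) *v fst (g s))
          \<le> L\<^sup>2 * (R * exp (L * t)) * (t - s + h)\<^sup>2"
      using mono time by blast
  qed
qed

lemma closed_relaxed_trajectory:
  fixes G :: "'m::finite \<Rightarrow> real ^ 'n ^ 'n"
  shows "closed {g. relaxed_trajectory G b h g}"
proof -
  have coord: "continuous_on UNIV (\<lambda>g::real \<Rightarrow> (real ^ 'n) \<times> (real ^ 'm). g t)" for t
    by simp
  have mv: "continuous_on UNIV (\<lambda>g::real \<Rightarrow> (real ^ 'n) \<times> (real ^ 'm). G i *v fst (g t))" for i t
    by (intro continuous_intros coord bounded_linear.continuous_on[OF matrix_vector_mul_bounded_linear])
  show ?thesis
    unfolding relaxed_trajectory_def comb_mult vector_minus_component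
    by (intro closed_Collect_all closed_Collect_imp closed_Collect_conj open_Collect_const
        closed_Collect_le continuous_intros coord mv)
qed

lemma relaxed_trajectory_mono:
  assumes "relaxed_trajectory G b h g" "0 \<le> h" "h \<le> h'" "\<And>t. 0 \<le> b t"
  shows "relaxed_trajectory G b h' g"
  unfolding relaxed_trajectory_def
proof (intro allI impI)
  fix s t :: real
  assume st: "0 \<le> s \<and> s \<le> t"
  have "b t * (t - s + h)\<^sup>2 \<le> b t * (t - s + h')\<^sup>2"
    using assms st by (intro mult_left_mono power_mono) auto
  then show "(\<forall>i. snd (g s) $ i \<le> snd (g t) $ i) \<and>
      \<bar>(\<Sum>i\<in>UNIV. snd (g t) $ i - snd (g s) $ i) - (t - s)\<bar> \<le> h' \<and>
      norm (fst (g t) - fst (g s) - comb G (snd (g t) - snd (g s)) *v fst (g s))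
        \<le> b t * (t - s + h')\<^sup>2"
    using assms(1)[unfolded relaxed_trajectory_def, rule_format, OF st] assms(3)
    by (meson order_trans)
qed

lemma relaxed_trajectory_limit:
  assumes "\<And>n. relaxed_trajectory G b (1 / real (Suc n)) g"
  shows "relaxed_trajectory G b 0 g"
  unfolding relaxed_trajectory_def
proof (intro allI impI)
  fix s t :: real
  assume st: "0 \<le> s \<and> s \<le> t"
  note * = assms[unfolded relaxed_trajectory_def, rule_format, OF st]
  have lim: "(\<lambda>n. 1 / real (Suc n)) \<longlonglongrightarrow> 0"
    using LIMSEQ_inverse_real_of_nat by (simp add: inverse_eq_divide)
  have "\<bar>(\<Sum>i\<in>UNIV. snd (g t) $ i - snd (g s) $ i) - (t - s)\<bar> \<le> 0"
    by (rule LIMSEQ_le_const[OF lim]) (use * in blast)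
  moreover have "norm (fst (g t) - fst (g s) - comb G (snd (g t) - snd (g s)) *v fst (g s))
      \<le> b t * (t - s + 0)\<^sup>2"
  proof (rule LIMSEQ_le_const)
    show "(\<lambda>n. b t * (t - s + 1 / real (Suc n))\<^sup>2) \<longlonglongrightarrow> b t * (t - s + 0)\<^sup>2"
      by (intro tendsto_intros lim)
  qed (use * in blast)
  ultimately show "(\<forall>i. snd (g s) $ i \<le> snd (g t) $ i) \<and>
      \<bar>(\<Sum>i\<in>UNIV. snd (g t) $ i - snd (g s) $ i) - (t - s)\<bar> \<le> 0 \<and>
      norm (fst (g t) - fst (g s) - comb G (snd (g t) - snd (g s)) *v fst (g s))
        \<le> b t * (t - s + 0)\<^sup>2"
    using * by blast
qed

text \<open>
  The step \<open>1 / Suc n\<close> tends to 0 while the horizon, \<open>n * Suc n\<close> steps, covers the time interval up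
  to \<open>n\<close>.  The sets of relaxed trajectories that stay fast up to time \<open>n\<close> are closed and decrease
  with \<open>n\<close>, so they have a common element in the compact product.
\<close>

lemma fast_relaxed_trajectory:
  fixes G :: "'m::finite \<Rightarrow> real ^ 'n ^ 'n"
  assumes "\<And>n. \<not> halving_time G (1 / real (Suc n)) (n * Suc n)"
  obtains g L C where "relaxed_trajectory G (\<lambda>t. C * exp (L * t)) 0 g" "0 \<le> L" "0 \<le> C"
    "\<And>t. norm (fst (g t)) \<le> C * exp (L * \<bar>t\<bar>)"
    "\<And>t. 0 \<le> t \<Longrightarrow> 1/2 \<le> speed G (fst (g t))"
proof -
  obtain R where R: "R > 0"
    "\<And>h N. \<not> halving_time G h N \<Longrightarrow>
       \<exists>X. euler_trajectory G h X \<and> norm (X 0) \<le> R \<and> (\<forall>k\<le>N. 1/2 \<le> speed G (X k))"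
    using normalised_fast_trajectories[of G] by blast
  obtain L where L: "L > 0" "\<And>i x. norm (G i *v x) \<le> L * norm x"
    using generator_norm_bound[of G] by blast
  let ?b = "\<lambda>t. L\<^sup>2 * (R * exp (L * t))"
  define K where "K = {g :: real \<Rightarrow> (real ^ 'n) \<times> (real ^ 'm).
      \<forall>t. g t \<in> cball 0 (R * exp (L * \<bar>t\<bar>)) \<times> cball 0 \<bar>t\<bar>}"
  define C where "C n = {g. relaxed_trajectory G ?b (1 / real (Suc n)) g \<and>
      (\<forall>t. 0 \<le> t \<and> t \<le> real n \<longrightarrow> 1/2 \<le> speed G (fst (g t)))}" for n
  have "compact K"
    unfolding K_def by (intro compact_dependent_functions compact_Times compact_cball)
  moreover have "closed (C n)" for n
  proof -
    have coord: "continuous_on UNIV (\<lambda>g::real \<Rightarrow> (real ^ 'n) \<times> (real ^ 'm). fst (g t))" for t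
      by (intro continuous_intros) simp
    have "closed {g :: real \<Rightarrow> (real ^ 'n) \<times> (real ^ 'm). 1/2 \<le> speed G (fst (g t))}" for t
      by (intro closed_Collect_le continuous_intros
          continuous_on_compose2[OF continuous_on_speed[of UNIV] coord]) auto
    then show ?thesis
      unfolding C_def
      by (intro closed_Collect_conj closed_Collect_all closed_Collect_imp open_Collect_const
          closed_relaxed_trajectory)
  qed
  moreover have "decseq C"
  proof (rule decseq_SucI, rule subsetI)
    fix n g
    assume "g \<in> C (Suc n)"
    then have g: "relaxed_trajectory G ?b (1 / real (Suc (Suc n))) g"
      "\<And>t. 0 \<le> t \<Longrightarrow> t \<le> real (Suc n) \<Longrightarrow> 1/2 \<le> speed G (fst (g t))"
      by (auto simp: C_def)
    have "relaxed_trajectory G ?b (1 / real (Suc n)) g"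
      by (rule relaxed_trajectory_mono[OF g(1)]) (use R(1) in \<open>auto simp: frac_le\<close>)
    then show "g \<in> C n"
      using g(2) by (auto simp: C_def)
  qed
  moreover have "K \<inter> C n \<noteq> {}" for n
  proof -
    let ?h = "1 / real (Suc n)"
    obtain X where X: "euler_trajectory G ?h X" "norm (X 0) \<le> R"
      "\<And>k. k \<le> n * Suc n \<Longrightarrow> 1/2 \<le> speed G (X k)"
      using R(2)[OF assms[of n]] by blast
    obtain c where c: "\<And>k. X (Suc k) = X k + ?h *\<^sub>R (G (c k) *v X k)"
      using X(1) unfolding euler_trajectory_def by metis
    define g where "g t = (X (nat \<lfloor>t / ?h\<rfloor>), ?h *\<^sub>R occupation c (nat \<lfloor>t / ?h\<rfloor>))" for t
    have h: "0 < ?h" by simp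
    note rel = euler_imp_relaxed_trajectory[where G = G and h = ?h and X = X and c = c,
        OF c h L(2) less_imp_le[OF L(1)] X(2), folded g_def]
    have "1/2 \<le> speed G (fst (g t))" if "0 \<le> t" "t \<le> real n" for t
    proof -
      have "t / ?h = t * real (Suc n)"
        by simp
      also have "\<dots> \<le> real n * real (Suc n)"
        using that(2) by (rule mult_right_mono) simp
      also have "\<dots> = real (n * Suc n)"
        by (rule of_nat_mult[symmetric])
      finally have "t / ?h \<le> real (n * Suc n)" .
      then have "nat \<lfloor>t / ?h\<rfloor> \<le> n * Suc n"
        by linarith
      then show ?thesis
        unfolding g_def fst_conv by (rule X(3))
    qed
    then have "g \<in> K \<inter> C n"
      using rel by (auto simp: K_def C_def mem_Times_iff)
    then show ?thesis by blast
  qed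
  ultimately obtain g where g: "g \<in> K" "\<And>n. g \<in> C n"
    using compact_decreasing_closed[of K C] by blast
  \<comment> \<open>One constant that serves in the error term and in the bound on the state.\<close>
  define D where "D = max R (L\<^sup>2 * R)"
  have "relaxed_trajectory G ?b 0 g"
    using g(2) by (intro relaxed_trajectory_limit) (simp add: C_def)
  moreover have "?b t \<le> D * exp (L * t)" for t
    unfolding D_def using mult_right_mono[of "L\<^sup>2 * R" "max R (L\<^sup>2 * R)" "exp (L * t)"] by simp
  ultimately have "relaxed_trajectory G (\<lambda>t. D * exp (L * t)) 0 g"
    unfolding relaxed_trajectory_def by (meson mult_right_mono order_trans zero_le_power2)
  moreover have "norm (fst (g t)) \<le> D * exp (L * \<bar>t\<bar>)" for t
  proof -
    have "norm (fst (g t)) \<le> R * exp (L * \<bar>t\<bar>)"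
      using g(1) by (auto simp: K_def mem_Times_iff)
    also have "\<dots> \<le> D * exp (L * \<bar>t\<bar>)"
      by (intro mult_right_mono) (simp_all add: D_def)
    finally show ?thesis .
  qed
  moreover have "1/2 \<le> speed G (fst (g t))" if "0 \<le> t" for t
  proof -
    obtain n where "t \<le> real n"
      using real_arch_simple by blast
    then show ?thesis
      using g(2)[of n] that by (simp add: C_def)
  qed
  moreover have "0 \<le> D"
    using R(1) by (simp add: D_def)
  ultimately show thesis
    using that L(1) less_imp_le by blast
qed

section \<open>Continuous-time solutions from relaxed trajectories\<close>

text \<open>
  If monotone functions share the elapsed time among themselves, their interval measures add up to
  Lebesgue measure.  Each of them is therefore dominated by it and has a Radon--Nikodym density, and
  the densities add up to 1 almost everywhere.  On the exceptional null set any weight vector does.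
\<close>

lemma time_split_density:
  fixes F :: "'m::finite \<Rightarrow> real \<Rightarrow> real"
  assumes mono: "\<And>i s t. s \<le> t \<Longrightarrow> F i s \<le> F i t"
    and total: "\<And>s t. s \<le> t \<Longrightarrow> (\<Sum>i\<in>UNIV. F i t - F i s) = t - s"
  obtains w :: "real \<Rightarrow> real ^ 'm" where "w \<in> borel_measurable borel" "\<And>t. w t \<in> weights"
    "\<And>i a b. a \<le> b \<Longrightarrow> ((\<lambda>t. w t $ i) has_integral (F i b - F i a)) {a..b}"
proof -
  have lip: "\<bar>F i t - F i s\<bar> \<le> \<bar>t - s\<bar>" for i s t
  proof -
    have *: "F i t - F i s \<le> t - s" if "s \<le> t" for s t
      using member_le_sum[of i UNIV "\<lambda>i. F i t - F i s"] total[OF that] mono[OF that] by auto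
    show ?thesis
      using *[of s t] *[of t s] mono[of s t i] mono[of t s i] by (cases "s \<le> t") auto
  qed
  have cont: "continuous_on UNIV (F i)" for i
  proof -
    have "1-lipschitz_on UNIV (F i)"
      using lip by (auto simp: lipschitz_on_def dist_real_def)
    then show ?thesis by (rule lipschitz_on_continuous_on)
  qed
  define M where "M i = interval_measure (F i)" for i
  have sets_M [measurable_cong]: "sets (M i) = sets borel" for i
    by (simp add: M_def)
  have Icc: "emeasure (M i) {a..b} = F i b - F i a" if "a \<le> b" for i a b
    unfolding M_def using that mono cont by (intro emeasure_interval_measure_Icc)
  have Ioo: "emeasure (M i) (box a b) = F i b - F i a" if "a \<le> b" for i a b
  proof -
    have "emeasure (M i) {a, b} = 0"
    proof -
      have "emeasure (M i) ({a..a} \<union> {b..b}) \<le> emeasure (M i) {a..a} + emeasure (M i) {b..b}"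
        by (rule emeasure_subadditive) auto
      also have "\<dots> = 0" using Icc[of a a i] Icc[of b b i] by simp
      finally show ?thesis by (simp add: insert_commute)
    qed
    then have "{a, b} \<in> null_sets (M i)"
      by (auto simp: null_sets_def)
    moreover have "box a b = {a..b} - {a, b}"
      by (auto simp: box_real)
    ultimately show ?thesis
      using Icc[OF that, of i] by (simp add: emeasure_Diff_null_set sets_M)
  qed
  define N where "N = measure_of UNIV (sets borel) (\<lambda>A. \<Sum>i\<in>UNIV. emeasure (M i) A)"
  have sets_N: "sets N = sets borel"
    by (simp add: N_def)
      (metis sets.sigma_sets_eq space_borel)
  have em_N: "emeasure N A = (\<Sum>i\<in>UNIV. emeasure (M i) A)" if "A \<in> sets borel" for A
    unfolding N_def
  proof (rule emeasure_measure_of_sigma)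
    show "sigma_algebra UNIV (sets (borel :: real measure))"
      by (metis sets.sigma_algebra_axioms space_borel)
    show "positive (sets borel) (\<lambda>A. \<Sum>i\<in>UNIV. emeasure (M i) A)"
      by (simp add: positive_def)
    show "countably_additive (sets borel) (\<lambda>A. \<Sum>i\<in>UNIV. emeasure (M i) A)"
    proof (rule countably_additiveI)
      fix B :: "nat \<Rightarrow> real set"
      assume B: "range B \<subseteq> sets borel" "disjoint_family B"
      have "(\<Sum>n. \<Sum>i\<in>UNIV. emeasure (M i) (B n)) = (\<Sum>i\<in>UNIV. \<Sum>n. emeasure (M i) (B n))"
        by (rule suminf_sum) auto
      also have "\<dots> = (\<Sum>i\<in>UNIV. emeasure (M i) (\<Union>n. B n))"
        using B by (intro sum.cong refl suminf_emeasure) (auto simp: sets_M)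
      finally show "(\<Sum>n. \<Sum>i\<in>UNIV. emeasure (M i) (B n)) = (\<Sum>i\<in>UNIV. emeasure (M i) (\<Union>n. B n))" .
    qed
  qed (rule that)
  have "lborel = N"
  proof (rule lborel_eqI)
    fix l u :: real
    assume "\<And>b. b \<in> Basis \<Longrightarrow> l \<bullet> b \<le> u \<bullet> b"
    then have lu: "l \<le> u" by simp
    have "emeasure N (box l u) = (\<Sum>i\<in>UNIV. ennreal (F i u - F i l))"
      using em_N[of "box l u"] Ioo[OF lu] by simp
    also have "\<dots> = ennreal (u - l)"
      using total[OF lu] mono[OF lu] by (simp add: sum_ennreal)
    finally show "emeasure N (box l u) = (\<Prod>b\<in>Basis. (u - l) \<bullet> b)"
      by simp
  qed (rule sets_N)
  then have sum_M: "emeasure lborel A = (\<Sum>i\<in>UNIV. emeasure (M i) A)" if "A \<in> sets borel" for A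
    using em_N that by simp
  have "\<exists>f\<in>borel_measurable lborel. density lborel f = M i" for i
  proof (rule sigma_finite_measure.Radon_Nikodym[OF sigma_finite_lborel])
    show "absolutely_continuous lborel (M i)"
      unfolding absolutely_continuous_def
    proof
      fix A :: "real set"
      assume A: "A \<in> null_sets lborel"
      then have "(\<Sum>i\<in>UNIV. emeasure (M i) A) = 0"
        using sum_M[of A] by (auto simp: null_sets_def)
      then show "A \<in> null_sets (M i)"
        using A by (auto simp: null_sets_def sets_M)
    qed
  qed (simp add: sets_M)
  then have "\<forall>i. \<exists>f. f \<in> borel_measurable borel \<and> density lborel f = M i"
    by (simp add: Bex_def)
  then obtain f where f [measurable]: "\<And>i. f i \<in> borel_measurable borel"
    and dens: "\<And>i. density lborel (f i) = M i"
    by metis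
  have em_f: "(\<integral>\<^sup>+t. f i t * indicator A t \<partial>lborel) = emeasure (M i) A" if "A \<in> sets borel" for i A
    using that by (simp add: emeasure_density flip: dens)
  have "density lborel (\<lambda>t. \<Sum>i\<in>UNIV. f i t) = density lborel (\<lambda>t. 1)"
  proof (rule measure_eqI)
    fix A :: "real set"
    assume "A \<in> sets (density lborel (\<lambda>t. \<Sum>i\<in>UNIV. f i t))"
    then have A [measurable]: "A \<in> sets borel" by simp
    have "emeasure (density lborel (\<lambda>t. \<Sum>i\<in>UNIV. f i t)) A = (\<integral>\<^sup>+t. (\<Sum>i\<in>UNIV. f i t) * indicator A t \<partial>lborel)"
      by (rule emeasure_density) auto
    also have "\<dots> = (\<Sum>i\<in>UNIV. \<integral>\<^sup>+t. f i t * indicator A t \<partial>lborel)"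
      by (subst nn_integral_sum[symmetric]) (auto simp: sum_distrib_right simp del: sum_mult_indicator sum_indicator_mult)
    also have "\<dots> = emeasure lborel A"
      using em_f sum_M by simp
    finally show "emeasure (density lborel (\<lambda>t. \<Sum>i\<in>UNIV. f i t)) A = emeasure (density lborel (\<lambda>t. 1)) A"
      by (simp add: emeasure_density)
  qed simp
  then have sum_f: "AE t in lborel. (\<Sum>i\<in>UNIV. f i t) = 1"
    by (intro sigma_finite_measure.density_unique[OF sigma_finite_lborel]) auto
  define w :: "real \<Rightarrow> real ^ 'm" where
    "w t = (if (\<Sum>i\<in>UNIV. f i t) = 1 then (\<chi> i. enn2real (f i t)) else axis undefined 1)" for t
  have fin: "f i t < top" if "(\<Sum>i\<in>UNIV. f i t) = 1" for i t
    using member_le_sum[of i UNIV "\<lambda>i. f i t"] that by (auto simp: less_top intro: le_less_trans)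
  have meas: "w \<in> borel_measurable borel"
  proof (subst borel_measurable_euclidean_space, safe)
    fix b :: "real ^ 'm"
    assume "b \<in> Basis"
    then obtain i where b: "b = axis i 1"
      by (auto simp: Basis_vec_def)
    have "(\<lambda>t. w t \<bullet> b) = (\<lambda>t. if (\<Sum>i\<in>UNIV. f i t) = 1 then enn2real (f i t) else axis undefined 1 $ i)"
      by (auto simp: w_def b inner_axis)
    then show "(\<lambda>t. w t \<bullet> b) \<in> borel_measurable borel"
      by simp
  qed
  have wts: "w t \<in> weights" for t
  proof (cases "(\<Sum>i\<in>UNIV. f i t) = 1")
    case True
    have "(\<Sum>i\<in>UNIV. enn2real (f i t)) = enn2real (\<Sum>i\<in>UNIV. f i t)"
      using fin[OF True] by (subst enn2real_sum) auto
    then show ?thesis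
      using True by (simp add: weights_def w_def)
  next
    case False
    then show ?thesis
      by (simp add: weights_def w_def axis_def)
  qed
  have "((\<lambda>t. w t $ i) has_integral (F i b - F i a)) {a..b}" if "a \<le> b" for i a b
  proof -
    have [measurable]: "(\<lambda>t. w t $ i) \<in> borel_measurable borel"
      using borel_measurable_euclidean_space[THEN iffD1, rule_format, OF meas, of "axis i 1"]
      by (simp add: inner_axis axis_in_Basis_iff)
    have "(\<integral>\<^sup>+t. ennreal (w t $ i * indicator {a..b} t) \<partial>lborel) = (\<integral>\<^sup>+t. f i t * indicator {a..b} t \<partial>lborel)"
    proof (rule nn_integral_cong_AE)
      show "AE t in lborel. ennreal (w t $ i * indicator {a..b} t) = f i t * indicator {a..b} t"
        using sum_f
      proof eventually_elim
        case (elim t)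
        then show ?case
          using fin[OF elim, of i] by (auto simp: w_def indicator_def)
      qed
    qed
    also have "\<dots> = ennreal (F i b - F i a)"
      using em_f[of "{a..b}"] Icc[OF that] by simp
    finally have "((\<lambda>t. w t $ i * indicator {a..b} t) has_integral (F i b - F i a)) UNIV"
      using wts mono[OF that, of i]
      by (intro nn_integral_has_integral) (auto simp: weights_def)
    moreover have "(\<lambda>t. w t $ i * indicator {a..b} t) = (\<lambda>t. if t \<in> {a..b} then w t $ i else 0)"
      by auto
    ultimately show ?thesis
      using has_integral_restrict_UNIV[of "{a..b}" "\<lambda>t. w t $ i"] by metis
  qed
  with meas wts show thesis using that by blast
qed

text \<open>
  Increments of second order force the derivative to vanish.
\<close>

lemma quadratic_increments_imp_constant:
  fixes D :: "real \<Rightarrow> 'a::real_normed_vector"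
  assumes "\<And>s t. 0 \<le> s \<Longrightarrow> s \<le> t \<Longrightarrow> t \<le> T \<Longrightarrow> norm (D t - D s) \<le> C * (t - s)\<^sup>2" "0 \<le> T"
  shows "D T = D 0"
proof -
  have sym: "norm (D t - D s) \<le> C * (t - s)\<^sup>2" if "s \<in> {0..T}" "t \<in> {0..T}" for s t
    using assms(1)[of s t] assms(1)[of t s] that
    by (cases "s \<le> t") (auto simp: norm_minus_commute power2_commute)
  have "(D has_derivative (\<lambda>h. 0)) (at s within {0..T})" if s: "s \<in> {0..T}" for s
    unfolding has_derivative_within_alt
  proof (intro conjI allI impI bounded_linear_zero)
    fix e :: real
    assume "0 < e"
    show "\<exists>d>0. \<forall>y\<in>{0..T}. norm (y - s) < d \<longrightarrow> norm (D y - D s - 0) \<le> e * norm (y - s)"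
    proof (intro exI conjI ballI impI)
      show "0 < e / (\<bar>C\<bar> + 1)"
        using \<open>0 < e\<close> by (simp add: add_nonneg_pos)
      fix y
      assume y: "y \<in> {0..T}" "norm (y - s) < e / (\<bar>C\<bar> + 1)"
      have "norm (D y - D s) \<le> C * (y - s)\<^sup>2"
        using sym s y(1) by blast
      also have "\<dots> \<le> (\<bar>C\<bar> + 1) * \<bar>y - s\<bar> * \<bar>y - s\<bar>"
        by (simp add: power2_eq_square mult.assoc mult_right_mono)
      also have "\<dots> \<le> e * \<bar>y - s\<bar>"
        using y(2) by (intro mult_right_mono) (auto simp: pos_less_divide_eq mult.commute)
      finally show "norm (D y - D s - 0) \<le> e * norm (y - s)"
        by simp
    qed
  qed
  then obtain c where "\<forall>t\<in>{0..T}. D t = c"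
    using has_derivative_zero_constant[of "{0..T}" D] by auto
  then show ?thesis
    using assms(2) by simp
qed

text \<open>
  The weights \<open>w\<close> are the density of \<open>F\<close>.  Over \<open>{s..t}\<close>, both the increment of \<open>x\<close> and the integral
  of \<open>comb A (w r) (x r)\<close> agree with \<open>comb A (F t - F s) (x s)\<close> up to second order: the former
  by definition, the latter because \<open>x\<close> is Lipschitz and \<open>w\<close> integrates to \<open>F t - F s\<close>.  Hence
  their difference \<open>D\<close> is constant.
\<close>

lemma relaxed_trajectory_imp_solution_ct:
  fixes A :: "'m::finite \<Rightarrow> real ^ 'n ^ 'n"
  assumes g: "relaxed_trajectory A (\<lambda>t. C * exp (L * t)) 0 g" and L: "0 \<le> L" "0 \<le> C"
    and bound: "\<And>t. norm (fst (g t)) \<le> C * exp (L * \<bar>t\<bar>)"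
  obtains w where "w \<in> borel_measurable borel" "\<And>t. w t \<in> weights"
    "solution_ct A w (\<lambda>t. fst (g t))"
proof -
  define x where "x t = fst (g t)" for t
  define F where "F t = snd (g t)" for t
  have F_mono: "F s $ i \<le> F t $ i"
    and F_total: "(\<Sum>i\<in>UNIV. F t $ i - F s $ i) = t - s"
    and x_incr: "norm (x t - x s - comb A (F t - F s) *v x s) \<le> C * exp (L * t) * (t - s)\<^sup>2"
    if "0 \<le> s" "s \<le> t" for s t i
    using g that unfolding relaxed_trajectory_def x_def F_def by auto
  \<comment> \<open>The density lemma needs the time to be split on the whole line; for negative times it is
     split evenly.\<close>
  define F' where "F' i t = (if 0 \<le> t then F t $ i else F 0 $ i + t / real CARD('m))" for i t
  have F'_mono: "F' i s \<le> F' i t" if "s \<le> t" for i s t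
  proof -
    have "s / real CARD('m) \<le> t / real CARD('m)"
      using that by (simp add: divide_right_mono)
    moreover have "s / real CARD('m) \<le> 0" if "s < 0"
      using that by (simp add: divide_nonpos_pos)
    ultimately show ?thesis
      using F_mono[of s t i] F_mono[of 0 t i] that by (fastforce simp: F'_def)
  qed
  have F'_total: "(\<Sum>i\<in>UNIV. F' i t - F' i s) = t - s" if "s \<le> t" for s t
  proof -
    have *: "(\<Sum>i\<in>UNIV. F' i t - F' i 0) = t" for t
      using F_total[of 0 t] by (cases "0 \<le> t") (simp_all add: F'_def)
    have "(\<Sum>i\<in>UNIV. F' i t - F' i s) = (\<Sum>i\<in>UNIV. F' i t - F' i 0) - (\<Sum>i\<in>UNIV. F' i s - F' i 0)"
      by (simp add: sum_subtractf)
    then show ?thesis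
      unfolding * .
  qed
  obtain w where w: "w \<in> borel_measurable borel" "\<And>t. w t \<in> weights"
    "\<And>i a b. a \<le> b \<Longrightarrow> ((\<lambda>t. w t $ i) has_integral (F' i b - F' i a)) {a..b}"
    using time_split_density[of F', OF F'_mono F'_total] by blast
  have w_nonneg: "0 \<le> w t $ i" and w_sum: "(\<Sum>i\<in>UNIV. w t $ i) = 1" for t i
    using w(2) by (auto simp: weights_def)
  have w_int: "((\<lambda>r. comb A (w r) *v y) has_integral (comb A (F t - F s) *v y)) {s..t}"
    if "0 \<le> s" "s \<le> t" for s t y
  proof -
    have "((\<lambda>r. w r $ i) has_integral ((F t - F s) $ i)) {s..t}" for i
      using w(3)[OF that(2), of i] that by (simp add: F'_def)
    then show ?thesis
      unfolding comb_mult by (intro has_integral_sum has_integral_scaleR_left) auto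
  qed
  obtain M where M: "0 < M" "\<And>i x. norm (A i *v x) \<le> M * norm x"
    using generator_norm_bound[of A] by blast
  have comb_bound: "norm (comb A (w r) *v y) \<le> M * norm y" for r y
    using norm_comb_le[of "w r" A y "M * norm y"] M(2) by (simp add: w_nonneg w_sum)
  have "(\<lambda>s. comb A (w s) *v x s) absolutely_integrable_on {0..T} \<and>
        x T = x 0 + integral {0..T} (\<lambda>s. comb A (w s) *v x s)" if T: "0 \<le> T" for T
  proof -
    define B where "B = C * exp (L * T)"
    define K where "K = M * B + B * T"
    define u where "u s = comb A (w s) *v x s" for s
    have B: "0 \<le> B" "0 \<le> K"
      using L M(1) T by (simp_all add: B_def K_def)
    have exp_le: "C * exp (L * t) \<le> B" if "t \<le> T" for t
      unfolding B_def using that L by (intro mult_left_mono) (simp_all add: mult_left_mono)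
    have x_bound: "norm (x t) \<le> B" if "0 \<le> t" "t \<le> T" for t
      using bound[of t] exp_le[of t] that by (simp add: x_def)
    have x_quad: "norm (x t - x s - comb A (F t - F s) *v x s) \<le> B * (t - s)\<^sup>2"
      if "0 \<le> s" "s \<le> t" "t \<le> T" for s t
      using x_incr[OF that(1,2)] mult_right_mono[OF exp_le[OF that(3)], of "(t - s)\<^sup>2"] by simp
    have x_lip: "norm (x t - x s) \<le> K * (t - s)" if "0 \<le> s" "s \<le> t" "t \<le> T" for s t
    proof -
      have "norm (comb A (F t - F s) *v x s) \<le> (\<Sum>i\<in>UNIV. (F t - F s) $ i) * (M * B)"
      proof (rule norm_comb_le)
        show "0 \<le> (F t - F s) $ i" for i
          using F_mono[OF that(1,2), of i] by simp
        show "norm (A i *v x s) \<le> M * B" for i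
          using M x_bound[of s] that by (meson less_imp_le mult_left_mono order_trans)
      qed
      also have "\<dots> = (t - s) * (M * B)"
        using F_total[OF that(1,2)] by simp
      finally have "norm (comb A (F t - F s) *v x s) \<le> (t - s) * (M * B)" .
      moreover have "B * (t - s)\<^sup>2 \<le> B * (T * (t - s))"
        unfolding power2_eq_square using that B by (intro mult_left_mono mult_right_mono) auto
      moreover have "norm (x t - x s) \<le> norm (x t - x s - comb A (F t - F s) *v x s)
          + norm (comb A (F t - F s) *v x s)"
        using norm_triangle_ineq[of "x t - x s - comb A (F t - F s) *v x s"
            "comb A (F t - F s) *v x s"] by simp
      ultimately have "norm (x t - x s) \<le> B * (T * (t - s)) + (t - s) * (M * B)"
        using x_quad[OF that] by linarith
      then show ?thesis
        by (simp add: K_def algebra_simps)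
    qed
    have "K-lipschitz_on {0..T} x"
    proof (rule lipschitz_onI)
      fix s t assume "s \<in> {0..T}" "t \<in> {0..T}"
      then show "dist (x s) (x t) \<le> K * dist s t"
        using x_lip[of s t] x_lip[of t s]
        by (cases "s \<le> t") (auto simp: dist_norm norm_minus_commute)
    qed (rule B)
    then have x_cont: "continuous_on {0..T} x"
      by (rule lipschitz_on_continuous_on)
    have x_meas: "(\<lambda>r. A i *v x r) \<in> borel_measurable (lebesgue_on {0..T})" for i
      by (intro continuous_imp_measurable_on_sets_lebesgue lmeasurable_interval
          bounded_linear.continuous_on[OF matrix_vector_mul_bounded_linear x_cont]) auto
    have "w \<in> borel_measurable (lebesgue_on {0..T})"
      using w(1) by (intro measurable_restrict_space1 measurable_completion) simp
    then have w_meas: "(\<lambda>r. w r $ i) \<in> borel_measurable (lebesgue_on {0..T})" for i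
      by (rule measurable_compose[OF _ borel_measurable_continuous_onI])
         (intro continuous_intros)
    have "u absolutely_integrable_on {0..T}"
    proof (rule measurable_bounded_by_integrable_imp_absolutely_integrable)
      show "u \<in> borel_measurable (lebesgue_on {0..T})"
        unfolding u_def[abs_def] comb_mult
        by (intro borel_measurable_sum borel_measurable_scaleR w_meas x_meas)
      show "norm (u r) \<le> M * B" if "r \<in> {0..T}" for r
        using comb_bound[of r "x r"] x_bound[of r] that M(1)
        by (auto simp: u_def intro: order_trans mult_left_mono)
    qed (auto intro: integrable_const_ivl)
    note u_abs = this
    then have u_int: "u integrable_on {0..T}"
      by (rule set_lebesgue_integral_eq_integral)
    define D where "D t = x t - integral {0..t} u" for t
    have "norm (D t - D s) \<le> (B + M * K) * (t - s)\<^sup>2" if st: "0 \<le> s" "s \<le> t" "t \<le> T" for s t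
    proof -
      have sub: "u integrable_on {s..t}" "u integrable_on {0..t}"
        using integrable_on_subinterval[OF u_int] st by auto
      have D: "D t - D s = x t - x s - integral {s..t} u"
        using Henstock_Kurzweil_Integration.integral_combine[OF st(1,2) sub(2)]
        by (simp add: D_def algebra_simps)
      have diff: "((\<lambda>r. u r - comb A (w r) *v x s) has_integral
          (integral {s..t} u - comb A (F t - F s) *v x s)) {s..t}"
        by (intro has_integral_diff integrable_integral sub w_int st)
      have "norm (integral {s..t} u - comb A (F t - F s) *v x s) \<le> (M * (K * (t - s))) * measure lborel {s..t}"
      proof (rule has_integral_bound_real[OF _ finite.emptyI diff])
        show "0 \<le> M * (K * (t - s))"
          using M(1) B st by simp
        fix r assume "r \<in> {s..t} - {}"
        then have r: "r \<in> {s..t}" by simp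
        have "u r - comb A (w r) *v x s = comb A (w r) *v (x r - x s)"
          by (simp add: u_def matrix_vector_mult_diff_distrib)
        also have "norm \<dots> \<le> M * norm (x r - x s)"
          by (rule comb_bound)
        also have "\<dots> \<le> M * (K * (t - s))"
        proof (intro mult_left_mono)
          have "norm (x r - x s) \<le> K * (r - s)"
            using x_lip[of s r] r st by auto
          also have "\<dots> \<le> K * (t - s)"
            using r B by (intro mult_left_mono) auto
          finally show "norm (x r - x s) \<le> K * (t - s)" .
        qed (use M(1) in simp)
        finally show "norm (u r - comb A (w r) *v x s) \<le> M * (K * (t - s))" .
      qed
      also have "\<dots> = M * K * (t - s)\<^sup>2"
        using st by (simp add: power2_eq_square)
      finally have "norm (integral {s..t} u - comb A (F t - F s) *v x s) \<le> M * K * (t - s)\<^sup>2" .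
      moreover have "norm (D t - D s) \<le> norm (x t - x s - comb A (F t - F s) *v x s)
          + norm (integral {s..t} u - comb A (F t - F s) *v x s)"
        unfolding D by (rule order_trans[OF _ norm_triangle_ineq4]) (simp add: algebra_simps)
      ultimately show ?thesis
        using x_quad[OF st] by (simp add: distrib_right)
    qed
    then have "D T = D 0"
      using T by (rule quadratic_increments_imp_constant)
    then have "x T = x 0 + integral {0..T} u"
      by (simp add: D_def algebra_simps)
    then show ?thesis
      using u_abs unfolding u_def[abs_def] by blast
  qed
  then have "solution_ct A w (\<lambda>t. fst (g t))"
    unfolding solution_ct_def x_def by blast
  then show thesis
    using that w(1,2) by blast
qed

text \<open>
  A fast relaxed trajectory would be a solution for a measurable weight function.  Its limit would be
  an equilibrium, where the speed is 0, although by continuity it is at least \<open>1/2\<close>.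
\<close>

lemma strongly_convergent_ct_imp_halving_time:
  fixes A :: "'m::finite \<Rightarrow> real ^ 'n ^ 'n"
  assumes "strongly_convergent_ct A"
  shows "\<exists>n. halving_time A (1 / real (Suc n)) (n * Suc n)"
proof (rule ccontr)
  assume "\<not> ?thesis"
  then obtain g L C where g: "relaxed_trajectory A (\<lambda>t. C * exp (L * t)) 0 g" "0 \<le> L" "0 \<le> C"
    "\<And>t. norm (fst (g t)) \<le> C * exp (L * \<bar>t\<bar>)"
    and fast: "\<And>t. 0 \<le> t \<Longrightarrow> 1/2 \<le> speed A (fst (g t))"
    using fast_relaxed_trajectory[of A] by metis
  obtain w where w: "w \<in> borel_measurable borel" "\<And>t. w t \<in> weights"
    "solution_ct A w (\<lambda>t. fst (g t))"
    using relaxed_trajectory_imp_solution_ct[OF g] by blast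
  have "w \<in> borel_measurable (lebesgue_on {0..})"
    using w(1) by (intro measurable_restrict_space1 measurable_completion) simp
  then obtain xbar where xbar: "xbar \<in> equilibria_ct A" "((\<lambda>t. fst (g t)) \<longlongrightarrow> xbar) at_top"
    using assms w(2,3) unfolding strongly_convergent_ct_def by blast
  have "isCont (speed A) xbar"
    using continuous_on_speed[of UNIV A] by (simp add: continuous_on_eq_continuous_at)
  then have "((\<lambda>t. speed A (fst (g t))) \<longlongrightarrow> speed A xbar) at_top"
    by (rule isCont_tendsto_compose) (rule xbar(2))
  moreover have "\<forall>\<^sub>F t in at_top. 1/2 \<le> speed A (fst (g t))"
    using eventually_ge_at_top[of 0] by eventually_elim (rule fast)
  ultimately have "1/2 \<le> speed A xbar"
    by (intro tendsto_lowerbound) auto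
  moreover have "speed A xbar = 0"
    using xbar(1) by (simp add: speed_eq_0_iff equilibria_ct_def matrix_ker_def)
  ultimately show False by simp
qed

theorem theorem2:
  fixes A :: "'m::finite \<Rightarrow> real ^ 'n ^ 'n"
  shows "(strongly_convergent_dt A \<longrightarrow> (\<exists>V. weak_polyhedral_Lyapunov_dt A V)) \<and>
         (strongly_convergent_ct A \<longrightarrow> (\<exists>V. weak_polyhedral_Lyapunov_ct A V))"
proof (intro conjI impI)
  assume "strongly_convergent_dt A"
  then show "\<exists>V. weak_polyhedral_Lyapunov_dt A V"
    using strongly_convergent_dt_imp_halving_time halving_time_imp_Lyapunov_dt by blast
next
  assume "strongly_convergent_ct A"
  then obtain n where "halving_time A (1 / real (Suc n)) (n * Suc n)"
    using strongly_convergent_ct_imp_halving_time by blast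
  then show "\<exists>V. weak_polyhedral_Lyapunov_ct A V"
    by (rule halving_time_imp_Lyapunov_ct[rotated]) simp
qed

end
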